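(* Let $\mathcal P$ be an $\mathsf{NPO}\text{-}\mathsf{PB}$ problem with input size $s$, problem Hamiltonian $H_C$, QWOA parameters $(\boldsymbol\gamma,\mathbf t)$ and initial state $|\psi_0\rangle$. Then $$\operatorname{Var}_{\boldsymbol\gamma,\mathbf t}\big[L_{\boldsymbol\gamma,\mathbf t}(|\psi_0\rangle\langle\psi_0|,H_C)\big]=\Omega\!\left(\frac{1}{\mathrm{poly}(s)}\right),$$ so the QWOA loss for $\mathcal P$ exhibits no barren plateau (the variance is not $\mathcal O(b^{-s})$ for any $b>1$).
   Context: For an instance with feasible space $\mathcal S'$ and cost $C$, $|\psi_0\rangle=|\mathcal S'|^{-1/2}\sum_{z\in\mathcal S'}|z\rangle$, $H_C|z\rangle=C(z)|z\rangle$, and $H_M$ is the complete-graph (equivalently, up to identity, all-ones) matrix on $\mathcal S'$. The QWOA loss is $L_{\boldsymbol\gamma,\mathbf t}(\rho,O)=\operatorname{Tr}[U(\boldsymbol\gamma,\mathbf t)\rho U(\boldsymbol\gamma,\mathbf t)^\dagger O]$ with $U(\boldsymbol\gamma,\mathbf t)=\prod_{l=1}^p e^{-it_lH_M}e^{-i\gamma_lH_C}$. The DLA $\mathfrak g=\mathfrak g_{\mathrm{QWOA},\mathcal P}$ is the real Lie algebra generated by $iH_C,iH_M$ (closure under commutators). Being reductive, $\mathfrak g=\mathfrak g_1\oplus\cdots\oplus\mathfrak g_{r-1}\oplus\mathfrak g_r$ with $\mathfrak g_1,\dots,\mathfrak g_{r-1}$ simple ideals and $\mathfrak g_r$ the center.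 For a Hermitian $H$ and ideal $\mathfrak g_j$, the $\mathfrak g_j$-purity is $P_j(H)=\sum_{k=1}^{\dim\mathfrak g_j}|\operatorname{Tr}[E_k^\dagger H]|^2$ for an orthonormal (Hilbert–Schmidt) basis $\{E_k\}$ of $\mathfrak g_j$. The variance is the one given by the Lie-algebraic formula (for parameters making the circuit distributed as Haar measure on the Lie group of $\mathfrak g$): $\operatorname{Var}[L(\rho,O)]=\sum_{j=1}^{r-1}P_j(\rho)P_j(O)/\dim\mathfrak g_j$. $\mathsf{NPO}\text{-}\mathsf{PB}$: optimization problems with polynomial-size solutions, polynomial-time feasibility and cost evaluation, and costs in a discrete range of size polynomial in $s$.
   Formalization: The bound is claimed only for instances whose cost is not constant on the feasible space (for constant cost the algebra is abelian and the variance is 0); the consequence that the variance is not O(b^{-s}) is not stated separately. *)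

theory Defs
  imports Complex_Main
begin

text \<open>Operators on the Hilbert space spanned by a finite set S of basis states are
  represented as complex matrices indexed by S, i.e. functions z => w => complex that
  vanish outside S x S.\<close>

type_synonym 'z cmat = "'z \<Rightarrow> 'z \<Rightarrow> complex"

definition mmul :: "'z set \<Rightarrow> 'z cmat \<Rightarrow> 'z cmat \<Rightarrow> 'z cmat" where
  "mmul S A B = (\<lambda>i j. \<Sum>k\<in>S. A i k * B k j)"

definition bracket :: "'z set \<Rightarrow> 'z cmat \<Rightarrow> 'z cmat \<Rightarrow> 'z cmat" where
  "bracket S A B = (\<lambda>i j. mmul S A B i j - mmul S B A i j)"

definition zmat :: "'z cmat" where
  "zmat = (\<lambda>i j. 0)"

definition rcomb :: "'z cmat set \<Rightarrow> ('z cmat \<Rightarrow> real) \<Rightarrow> 'z cmat" where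
  "rcomb F c = (\<lambda>i j. \<Sum>b\<in>F. complex_of_real (c b) * b i j)"

definition rspan :: "'z cmat set \<Rightarrow> 'z cmat set" where
  "rspan B = {A. \<exists>F c. finite F \<and> F \<subseteq> B \<and> A = rcomb F c}"

definition rsubspace :: "'z cmat set \<Rightarrow> bool" where
  "rsubspace V \<longleftrightarrow> rspan V = V"

definition rindep :: "'z cmat set \<Rightarrow> bool" where
  "rindep B \<longleftrightarrow> (\<forall>F c. finite F \<and> F \<subseteq> B \<and> rcomb F c = zmat \<longrightarrow> (\<forall>b\<in>F. c b = 0))"

definition rdim :: "'z cmat set \<Rightarrow> nat" where
  "rdim V = card (SOME B. finite B \<and> rindep B \<and> rspan B = V)"

definition lie_closed :: "'z set \<Rightarrow> 'z cmat set \<Rightarrow> bool" where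
  "lie_closed S V \<longleftrightarrow> (\<forall>A\<in>V. \<forall>B\<in>V. bracket S A B \<in> V)"

definition gen_lie :: "'z set \<Rightarrow> 'z cmat set \<Rightarrow> 'z cmat set" where
  "gen_lie S X = \<Inter> {V. rsubspace V \<and> X \<subseteq> V \<and> lie_closed S V}"

definition lie_ideal :: "'z set \<Rightarrow> 'z cmat set \<Rightarrow> 'z cmat set \<Rightarrow> bool" where
  "lie_ideal S g I \<longleftrightarrow> rsubspace I \<and> I \<subseteq> g \<and> (\<forall>A\<in>g. \<forall>B\<in>I. bracket S A B \<in> I)"

definition simple_ideal :: "'z set \<Rightarrow> 'z cmat set \<Rightarrow> 'z cmat set \<Rightarrow> bool" where
  "simple_ideal S g I \<longleftrightarrow> lie_ideal S g I \<and>
     (\<exists>A\<in>I. \<exists>B\<in>I. bracket S A B \<noteq> zmat) \<and>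
     (\<forall>J. lie_ideal S I J \<longrightarrow> J = {zmat} \<or> J = I)"

definition hs :: "'z set \<Rightarrow> 'z cmat \<Rightarrow> 'z cmat \<Rightarrow> complex" where
  "hs S A B = (\<Sum>i\<in>S. \<Sum>j\<in>S. cnj (A i j) * B i j)"

definition hs_onb :: "'z set \<Rightarrow> 'z cmat set \<Rightarrow> 'z cmat set \<Rightarrow> bool" where
  "hs_onb S V B \<longleftrightarrow> finite B \<and> B \<subseteq> V \<and> rspan B = V \<and>
     (\<forall>E\<in>B. \<forall>F\<in>B. hs S E F = (if E = F then 1 else 0))"

definition purity :: "'z set \<Rightarrow> 'z cmat set \<Rightarrow> 'z cmat \<Rightarrow> real" where
  "purity S I H = (\<Sum>E\<in>(SOME B. hs_onb S I B). (cmod (hs S E H))^2)"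

definition H_C :: "'z set \<Rightarrow> ('z \<Rightarrow> int) \<Rightarrow> 'z cmat" where
  "H_C S C = (\<lambda>i j. if i \<in> S \<and> j = i then of_int (C i) else 0)"

definition H_M :: "'z set \<Rightarrow> 'z cmat" where
  "H_M S = (\<lambda>i j. if i \<in> S \<and> j \<in> S then 1 else 0)"

text \<open>rho = |psi_0><psi_0| with psi_0 the uniform superposition over S.\<close>
definition rho0 :: "'z set \<Rightarrow> 'z cmat" where
  "rho0 S = (\<lambda>i j. if i \<in> S \<and> j \<in> S then 1 / of_nat (card S) else 0)"

definition imul :: "'z cmat \<Rightarrow> 'z cmat" where
  "imul A = (\<lambda>i j. \<i> * A i j)"

definition qwoa_dla :: "'z set \<Rightarrow> ('z \<Rightarrow> int) \<Rightarrow> 'z cmat set" where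
  "qwoa_dla S C = gen_lie S {imul (H_C S C), imul (H_M S)}"

definition lie_variance :: "'z set \<Rightarrow> 'z cmat set \<Rightarrow> 'z cmat \<Rightarrow> 'z cmat \<Rightarrow> real" where
  "lie_variance S g rho Obs =
     (\<Sum>I\<in>{I. simple_ideal S g I}. purity S I rho * purity S I Obs / real (rdim I))"

definition qwoa_variance :: "'z set \<Rightarrow> ('z \<Rightarrow> int) \<Rightarrow> real" where
  "qwoa_variance S C = lie_variance S (qwoa_dla S C) (rho0 S) (H_C S C)"

end

theory Submission
  imports Defs "HOL-Library.Function_Algebras" "HOL-Analysis.Convex"
begin

text \<open>Let \<open>V\<close> be the set of attained costs, \<open>m = card V\<close>, and \<open>W\<close> the span of the uniform
  superpositions over the cost classes. The all-ones matrix is a multiple of the projection onto a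
  vector of \<open>W\<close> that is cyclic for \<open>H\<^sub>C\<close>, so the generated algebra is \<open>u(W)\<close> plus the line through
  \<open>i H\<^sub>C\<close>. Hence its brackets lie in \<open>su(W)\<close>, and \<open>su(W)\<close>, being simple, is its only simple ideal.
  The dimension of \<open>su(W)\<close> is at most \<open>2 m\<^sup>2\<close>. Pairing with one element of \<open>su(W)\<close> bounds a purity from
  below (Bessel): \<open>i (\<rho>\<^sub>0 - 1\<^sub>W/m)\<close> gives at least \<open>1 - 1/m\<close> for \<open>\<rho>\<^sub>0\<close>, and \<open>i diag(1, -1)\<close> on two distinct
  costs gives at least \<open>1/2\<close> for \<open>H\<^sub>C\<close>. So the variance is at least \<open>1 / (8 m\<^sup>2)\<close>, and \<open>m\<close> is
  polynomially bounded by the range hypothesis.\<close>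

section \<open>Real linear algebra of matrices\<close>

lemma sum_fun_apply: "(\<Sum>a\<in>F. f a) x = (\<Sum>a\<in>F. f a x)"
  by (induction F rule: infinite_finite_induct) auto

definition rscale :: "real \<Rightarrow> 'z cmat \<Rightarrow> 'z cmat" where
  "rscale r A = (\<lambda>i j. complex_of_real r * A i j)"

lemma rscale_apply [simp]: "rscale r A i j = complex_of_real r * A i j"
  by (simp add: rscale_def)

text \<open>Gives access to the library's theory of span, independence and dimension over the reals;
  the lemmas that follow translate \<open>rspan\<close>, \<open>rsubspace\<close> and
  \<open>rindep\<close> into it.\<close>

interpretation cm: vector_space rscale
  by unfold_locales (auto simp: fun_eq_iff algebra_simps)

lemma zmat_eq_0: "zmat = 0"
  by (auto simp: zmat_def fun_eq_iff)

lemma rcomb_eq_sum: "rcomb F c = (\<Sum>b\<in>F. rscale (c b) b)"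
  by (simp add: rcomb_def fun_eq_iff sum_fun_apply)

lemma rspan_eq_span: "rspan B = cm.span B"
  unfolding rspan_def cm.span_explicit rcomb_eq_sum by blast

lemma rsubspace_iff: "rsubspace V \<longleftrightarrow> cm.subspace V"
  by (simp add: rsubspace_def rspan_eq_span)

lemma rindep_iff: "rindep B \<longleftrightarrow> \<not> cm.dependent B"
  unfolding rindep_def cm.dependent_explicit rcomb_eq_sum zmat_eq_0 by blast

text \<open>Since \<open>rdim\<close> takes the size of a basis chosen by \<open>SOME\<close>, a
  finite basis has to be exhibited before the chosen one can be trusted. Positivity is kept because
  \<open>rdim\<close> later stands in a denominator.\<close>

lemma rdim_bounds:
  assumes V: "cm.subspace V" and F: "finite F" "V \<subseteq> cm.span F" and ne: "\<exists>A\<in>V. A \<noteq> 0"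
  shows "0 < rdim V" "rdim V \<le> card F"
proof -
  obtain B where B: "B \<subseteq> V" "\<not> cm.dependent B" "V \<subseteq> cm.span B"
    using cm.maximal_independent_subset by blast
  have "finite B"
    using cm.independent_span_bound[OF F(1) B(2)] B(1) F(2) by blast
  moreover have "rspan B = V"
    unfolding rspan_eq_span using B(1,3) V by (rule cm.span_subspace)
  ultimately have "finite B \<and> rindep B \<and> rspan B = V"
    using B(2) by (simp add: rindep_iff)
  then have *: "finite B' \<and> rindep B' \<and> rspan B' = V"
    if "B' = (SOME B. finite B \<and> rindep B \<and> rspan B = V)" for B'
    unfolding that by (rule someI)
  define B' where "B' = (SOME B. finite B \<and> rindep B \<and> rspan B = V)"
  have B': "finite B'" "\<not> cm.dependent B'" "cm.span B' = V"
    using *[OF B'_def] by (auto simp: rindep_iff rspan_eq_span)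
  have rd: "rdim V = card B'"
    by (simp add: rdim_def B'_def)
  have "B' \<noteq> {}" using B'(3) ne by auto
  then show "0 < rdim V" using B'(1) by (simp add: rd card_gt_0_iff)
  have "B' \<subseteq> cm.span F"
    using B'(3) F(2) cm.span_superset by blast
  then show "rdim V \<le> card F"
    using cm.independent_span_bound[OF F(1) B'(2)] by (simp add: rd)
qed

section \<open>Products, brackets and the Lie algebras u(S) and su(S)\<close>

lemma mmul_simps:
  "mmul S (A + B) D = mmul S A D + mmul S B D"
  "mmul S A (B + D) = mmul S A B + mmul S A D"
  "mmul S (A - B) D = mmul S A D - mmul S B D"
  "mmul S A (B - D) = mmul S A B - mmul S A D"
  "mmul S (rscale r A) B = rscale r (mmul S A B)"
  "mmul S A (rscale r B) = rscale r (mmul S A B)"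
  by (auto simp: mmul_def fun_eq_iff algebra_simps sum.distrib sum_subtractf sum_distrib_left)

lemma bracket_eq: "bracket S A B = mmul S A B - mmul S B A"
  by (simp add: bracket_def fun_eq_iff)

lemma bracket_simps:
  "bracket S (A + B) D = bracket S A D + bracket S B D"
  "bracket S A (B + D) = bracket S A B + bracket S A D"
  "bracket S (rscale r A) B = rscale r (bracket S A B)"
  "bracket S A (rscale r B) = rscale r (bracket S A B)"
  by (auto simp: bracket_eq mmul_simps fun_eq_iff algebra_simps)

lemma bracket_anticomm: "bracket S B A = - bracket S A B"
  by (simp add: bracket_eq)

text \<open>This is the Lie algebra u(S); its traceless part, defined next, is su(S). Entries
  outside the index set are forced to vanish so that equality of functions is equality of matrices
  on \<open>S\<close>.\<close>

definition skew :: "'z set \<Rightarrow> 'z cmat set" where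
  "skew S = {A. (\<forall>i j. i \<notin> S \<or> j \<notin> S \<longrightarrow> A i j = 0) \<and> (\<forall>i j. A j i = - cnj (A i j))}"

definition traceless_skew :: "'z set \<Rightarrow> 'z cmat set" where
  "traceless_skew S = {A \<in> skew S. (\<Sum>i\<in>S. A i i) = 0}"

lemma skewI:
  assumes "\<And>i j. i \<notin> S \<or> j \<notin> S \<Longrightarrow> A i j = 0" "\<And>i j. A j i = - cnj (A i j)"
  shows "A \<in> skew S"
  using assms unfolding skew_def by blast

lemma skew_outside: "A \<in> skew S \<Longrightarrow> i \<notin> S \<or> j \<notin> S \<Longrightarrow> A i j = 0"
  unfolding skew_def by blast

lemma skew_cnj: "A \<in> skew S \<Longrightarrow> cnj (A i j) = - A j i"
  unfolding skew_def by (metis (mono_tags, lifting) mem_Collect_eq add.inverse_inverse)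

lemma subspace_skew: "cm.subspace (skew S)"
proof (rule cm.subspaceI)
  fix A B :: "'a cmat" and r assume A: "A \<in> skew S"
  have "rscale r A j i = - cnj (rscale r A i j)" for i j
    using skew_cnj[OF A, of i j] by simp
  moreover have "rscale r A i j = 0" if "i \<notin> S \<or> j \<notin> S" for i j
    using skew_outside[OF A that] by simp
  ultimately show "rscale r A \<in> skew S" by (intro skewI)
  assume B: "B \<in> skew S"
  have "(A + B) j i = - cnj ((A + B) i j)" for i j
    using skew_cnj[OF A, of i j] skew_cnj[OF B, of i j] by simp
  moreover have "(A + B) i j = 0" if "i \<notin> S \<or> j \<notin> S" for i j
    using skew_outside[OF A that] skew_outside[OF B that] by simp
  ultimately show "A + B \<in> skew S" by (intro skewI)
qed (auto intro: skewI)

lemma subspace_traceless_skew: "cm.subspace (traceless_skew S)"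
proof (rule cm.subspaceI)
  show "0 \<in> traceless_skew S"
    using cm.subspace_0[OF subspace_skew] by (simp add: traceless_skew_def)
  fix A B :: "'a cmat" and r assume A: "A \<in> traceless_skew S"
  have "(\<Sum>i\<in>S. rscale r A i i) = complex_of_real r * (\<Sum>i\<in>S. A i i)"
    by (simp add: sum_distrib_left)
  then show "rscale r A \<in> traceless_skew S"
    using A cm.subspace_scale[OF subspace_skew, of A S r] by (simp add: traceless_skew_def)
  assume "B \<in> traceless_skew S"
  then show "A + B \<in> traceless_skew S"
    using A cm.subspace_add[OF subspace_skew, of A S B] by (simp add: traceless_skew_def sum.distrib)
qed

lemma bracket_in_skew:
  assumes "A \<in> skew S" "B \<in> skew S"
  shows "bracket S A B \<in> skew S"
proof -
  have "cnj (bracket S A B i j) = - bracket S A B j i" for i j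
  proof -
    have "cnj (A i k * B k j) = B j k * A k i" "cnj (B i k * A k j) = A j k * B k i" for k
      using assms by (simp_all add: skew_cnj)
    then show ?thesis by (simp add: bracket_def mmul_def)
  qed
  then have "bracket S A B j i = - cnj (bracket S A B i j)" for i j
    by (metis add.inverse_inverse)
  moreover have "bracket S A B i j = 0" if "i \<notin> S \<or> j \<notin> S" for i j
    using that skew_outside[OF assms(1)] skew_outside[OF assms(2)]
    unfolding bracket_def mmul_def by (elim disjE) simp_all
  ultimately show ?thesis by (intro skewI)
qed

lemma bracket_in_traceless_skew:
  assumes "A \<in> skew S" "B \<in> skew S"
  shows "bracket S A B \<in> traceless_skew S"
proof -
  have "(\<Sum>i\<in>S. mmul S A B i i) = (\<Sum>i\<in>S. mmul S B A i i)"
    unfolding mmul_def by (subst sum.swap) (simp add: mult.commute)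
  then show ?thesis
    using bracket_in_skew[OF assms] by (simp add: traceless_skew_def bracket_def sum_subtractf)
qed

section \<open>The Hilbert-Schmidt form, orthonormal bases and purity\<close>

lemma hs_simps:
  "hs S (A + B) D = hs S A D + hs S B D"
  "hs S A (B + D) = hs S A B + hs S A D"
  "hs S A (B - D) = hs S A B - hs S A D"
  "hs S (rscale r A) B = complex_of_real r * hs S A B"
  "hs S A (rscale r B) = complex_of_real r * hs S A B"
  "hs S 0 B = 0" "hs S A 0 = 0"
  by (auto simp: hs_def algebra_simps sum.distrib sum_subtractf sum_distrib_left)

lemma hs_sum_left: "hs S (\<Sum>a\<in>F. f a) D = (\<Sum>a\<in>F. hs S (f a) D)"
  by (induction F rule: infinite_finite_induct) (auto simp: hs_simps simp del: plus_fun_apply zero_fun_apply)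

lemma hs_sum_right: "hs S D (\<Sum>a\<in>F. f a) = (\<Sum>a\<in>F. hs S D (f a))"
  by (induction F rule: infinite_finite_induct) (auto simp: hs_simps simp del: plus_fun_apply zero_fun_apply)

lemma hs_skew_sym:
  assumes "A \<in> skew S" "B \<in> skew S"
  shows "hs S B A = hs S A B"
proof -
  have "cnj (B i j) * A i j = cnj (A j i) * B j i" for i j
    using assms by (simp add: skew_cnj)
  then show ?thesis
    unfolding hs_def by (subst sum.swap) simp
qed

lemma hs_cnj: "cnj (hs S A B) = hs S B A"
  by (simp add: hs_def mult.commute)

text \<open>Symmetry together with conjugate symmetry makes the form real on skew-Hermitian
  matrices. Orthogonal projection can therefore be done with real coefficients, the only ones
  available in a real span.\<close>

lemma hs_skew_real:
  assumes "A \<in> skew S" "B \<in> skew S"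
  shows "complex_of_real (Re (hs S A B)) = hs S A B"
  using hs_skew_sym[OF assms] hs_cnj[of S A B]
  by (metis Reals_cnj_iff of_real_Re)

lemma hs_self: "hs S A A = complex_of_real (\<Sum>i\<in>S. \<Sum>j\<in>S. (cmod (A i j))\<^sup>2)"
proof -
  have "cnj z * z = complex_of_real ((cmod z)\<^sup>2)" for z
    by (metis complex_norm_square mult.commute)
  then show ?thesis by (simp add: hs_def)
qed

lemma hs_self_eq_0:
  assumes "finite S" "A \<in> skew S" "hs S A A = 0"
  shows "A = 0"
proof -
  have "(\<Sum>i\<in>S. \<Sum>j\<in>S. (cmod (A i j))\<^sup>2) = 0"
    using assms(3) by (simp only: hs_self of_real_eq_0_iff)
  then have "A i j = 0" if "i \<in> S" "j \<in> S" for i j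
    using that assms(1) by (simp add: sum_nonneg_eq_0_iff sum_nonneg)
  then have "A i j = 0" for i j
    using skew_outside[OF assms(2)] by blast
  then show ?thesis by (simp add: fun_eq_iff)
qed

text \<open>Needed because \<open>purity\<close> selects its basis by \<open>SOME\<close>, which is
  meaningful only once an orthonormal basis exists. Each new generator contributes its normalised
  residual, or nothing when the residual is zero.\<close>

lemma gram_schmidt:
  assumes S: "finite S" and F: "finite F" "F \<subseteq> skew S"
  shows "\<exists>B. hs_onb S (cm.span F) B"
  using F
proof (induction F rule: finite_induct)
  case empty
  have "hs_onb S (cm.span {}) {}" by (simp add: hs_onb_def rspan_eq_span)
  then show "\<exists>B. hs_onb S (cm.span {}) B" by blast
next
  case (insert a F)
  then obtain B where B: "hs_onb S (cm.span F) B" by blast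
  have fB: "finite B" and BF: "B \<subseteq> cm.span F" and sB: "cm.span B = cm.span F"
    and orth: "\<And>D E. D \<in> B \<Longrightarrow> E \<in> B \<Longrightarrow> hs S D E = (if D = E then 1 else 0)"
    using B by (auto simp: hs_onb_def rspan_eq_span)
  have Bs: "B \<subseteq> skew S"
    using BF cm.span_minimal[OF _ subspace_skew, of F S] insert.prems by blast
  define p where "p = (\<Sum>E\<in>B. rscale (Re (hs S E a)) E)"
  have p: "p \<in> cm.span B"
    unfolding p_def by (intro cm.span_sum cm.span_scale cm.span_base)
  have pskew: "p \<in> skew S"
    using p cm.span_minimal[OF Bs subspace_skew] by blast
  define b where "b = a - p"
  have bskew: "b \<in> skew S"
    using insert.prems pskew cm.subspace_diff[OF subspace_skew, of a S p] by (simp add: b_def)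
  have ortho_b: "hs S E b = 0" if "E \<in> B" for E
  proof -
    have "hs S E p = (\<Sum>D\<in>B. if E = D then hs S D a else 0)"
      unfolding p_def hs_sum_right
    proof (rule sum.cong[OF refl])
      fix D assume D: "D \<in> B"
      have "complex_of_real (Re (hs S D a)) = hs S D a"
        using D Bs insert.prems by (intro hs_skew_real) auto
      then show "hs S E (rscale (Re (hs S D a)) D) = (if E = D then hs S D a else 0)"
        using orth[OF that D] by (simp add: hs_simps)
    qed
    also have "\<dots> = hs S E a" using that fB by simp
    finally show ?thesis by (simp add: b_def hs_simps)
  qed
  have span_b: "cm.span (insert b B) = cm.span (insert a F)"
  proof -
    have "cm.span (insert b B) = cm.span (insert a B)"
    proof (rule cm.span_eq[THEN iffD2], intro conjI)
      have pB: "p \<in> cm.span (insert x B)" for x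
        using p cm.span_mono[of B "insert x B"] by blast
      show "insert b B \<subseteq> cm.span (insert a B)"
        using pB by (auto simp: b_def intro!: cm.span_diff intro: cm.span_base)
      have "b + p \<in> cm.span (insert b B)"
        using pB by (intro cm.span_add) (auto intro: cm.span_base)
      then show "insert a B \<subseteq> cm.span (insert b B)"
        by (auto simp: b_def intro: cm.span_base)
    qed
    also have "\<dots> = cm.span (insert a F)"
      using sB by (simp add: cm.span_insert)
    finally show ?thesis .
  qed
  show ?case
  proof (cases "b = 0")
    case True
    then have "cm.span (insert a F) = cm.span B"
      using span_b by (simp add: cm.span_insert_0)
    then have "hs_onb S (cm.span (insert a F)) B" using B sB by simp
    then show ?thesis by blast
  next
    case False
    define r where "r = Re (hs S b b)"
    have rb: "hs S b b = complex_of_real r"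
      using hs_skew_real[OF bskew bskew] by (simp add: r_def)
    have "r \<noteq> 0" using False hs_self_eq_0[OF S bskew] rb by auto
    moreover have "r \<ge> 0" unfolding r_def hs_self by (simp add: sum_nonneg)
    ultimately have r: "r > 0" by simp
    define e where "e = rscale (1 / sqrt r) b"
    have eb: "hs S e e = 1"
    proof -
      have "1 / sqrt r * (1 / sqrt r * r) = 1"
        using r by (simp add: field_simps)
      then have "complex_of_real (1 / sqrt r * (1 / sqrt r * r)) = 1" by simp
      then show ?thesis by (simp only: e_def hs_simps rb of_real_mult)
    qed
    have oe: "hs S E e = 0" "hs S e E = 0" if "E \<in> B" for E
    proof -
      show "hs S E e = 0" using ortho_b[OF that] by (simp add: e_def hs_simps)
      then show "hs S e E = 0" using hs_cnj[of S E e] by simp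
    qed
    have span_e: "cm.span (insert e B) = cm.span (insert b B)"
    proof (rule cm.span_eq[THEN iffD2], intro conjI)
      show "insert e B \<subseteq> cm.span (insert b B)"
        by (auto simp: e_def intro!: cm.span_scale intro: cm.span_base)
      have "b = rscale (sqrt r) e" using r by (simp add: e_def)
      moreover have "rscale (sqrt r) e \<in> cm.span (insert e B)"
        by (intro cm.span_scale cm.span_base) simp
      ultimately show "insert b B \<subseteq> cm.span (insert e B)"
        by (auto intro: cm.span_base)
    qed
    have "e \<notin> B" using oe(1)[of e] eb by auto
    then have "hs_onb S (cm.span (insert a F)) (insert e B)"
      unfolding hs_onb_def rspan_eq_span
      using fB eb oe orth span_e span_b cm.span_superset[of "insert e B"]
      by auto
    then show ?thesis by blast
  qed
qed

lemma ex_hs_onb: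
  assumes "finite S" "finite F" "V \<subseteq> cm.span F" "cm.subspace V" "V \<subseteq> skew S"
  shows "\<exists>B. hs_onb S V B"
proof -
  obtain B where B: "B \<subseteq> V" "\<not> cm.dependent B" "V \<subseteq> cm.span B"
    using cm.maximal_independent_subset by blast
  have "finite B"
    using cm.independent_span_bound[OF assms(2) B(2)] B(1) assms(3) by blast
  moreover have "cm.span B = V"
    using B(1,3) assms(4) by (rule cm.span_subspace)
  ultimately show ?thesis
    using gram_schmidt[OF assms(1), of B] B(1) assms(5) by auto
qed

text \<open>Bessel's inequality: expand \<open>A\<close> in the orthonormal basis with real
  coefficients and apply Cauchy-Schwarz. \<open>H\<close> is arbitrary, so the lemma applies to the
  Hermitian matrices \<open>rho0\<close> and \<open>H_C\<close>, although \<open>V\<close> will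
  consist of skew-Hermitian ones.\<close>

lemma purity_ge:
  assumes ex: "\<exists>B. hs_onb S V B" and A: "A \<in> V"
  shows "(cmod (hs S A H))\<^sup>2 \<le> Re (hs S A A) * purity S V H"
proof -
  define B where "B = (SOME B. hs_onb S V B)"
  have "hs_onb S V B" unfolding B_def using ex by (rule someI_ex)
  then have fB: "finite B" and sB: "cm.span B = V"
    and orth: "\<And>D E. D \<in> B \<Longrightarrow> E \<in> B \<Longrightarrow> hs S D E = (if D = E then 1 else 0)"
    by (auto simp: hs_onb_def rspan_eq_span)
  obtain c where c: "A = (\<Sum>E\<in>B. rscale (c E) E)"
    using A unfolding sB[symmetric] cm.span_finite[OF fB] by auto
  have "hs S A A = (\<Sum>D\<in>B. \<Sum>E\<in>B. if D = E then complex_of_real ((c D)\<^sup>2) else 0)"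
    unfolding c hs_sum_left hs_sum_right
    by (intro sum.cong refl) (auto simp: hs_simps orth power2_eq_square)
  also have "\<dots> = complex_of_real (\<Sum>D\<in>B. (c D)\<^sup>2)" using fB by simp
  finally have AA: "Re (hs S A A) = (\<Sum>D\<in>B. (c D)\<^sup>2)" by simp
  have "hs S A H = (\<Sum>E\<in>B. complex_of_real (c E) * hs S E H)"
    by (simp add: c hs_sum_left hs_simps)
  then have "cmod (hs S A H) \<le> (\<Sum>E\<in>B. \<bar>c E\<bar> * cmod (hs S E H))"
    by (metis (no_types, lifting) norm_mult norm_of_real norm_sum sum.cong)
  then have "(cmod (hs S A H))\<^sup>2 \<le> (\<Sum>E\<in>B. \<bar>c E\<bar> * cmod (hs S E H))\<^sup>2"
    by (simp add: power_mono)
  also have "\<dots> \<le> (\<Sum>E\<in>B. \<bar>c E\<bar>\<^sup>2) * (\<Sum>E\<in>B. (cmod (hs S E H))\<^sup>2)"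
    by (rule Cauchy_Schwarz_ineq_sum)
  finally show ?thesis by (simp add: AA purity_def B_def)
qed

section \<open>Simplicity of the traceless skew-Hermitian matrices\<close>

definition unit_mat :: "'z \<Rightarrow> 'z \<Rightarrow> complex \<Rightarrow> 'z cmat" where
  "unit_mat u v z = (\<lambda>i j. if i = u \<and> j = v then z else 0)"

text \<open>For distinct indices these are the off-diagonal elements of su. For \<open>u = v\<close>
  the two terms overlap and leave \<open>z - cnj z\<close> on the diagonal, which is
  \<open>2 * z\<close> for imaginary \<open>z\<close>.\<close>

definition pair_mat :: "'z \<Rightarrow> 'z \<Rightarrow> complex \<Rightarrow> 'z cmat" where
  "pair_mat u v z = unit_mat u v z - unit_mat v u (cnj z)"

definition diag_mat :: "'z set \<Rightarrow> ('z \<Rightarrow> real) \<Rightarrow> 'z cmat" where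
  "diag_mat S d = (\<lambda>i j. if i \<in> S \<and> j = i then \<i> * complex_of_real (d i) else 0)"

lemma pair_mat_apply:
  "pair_mat u v z i j = (if i = u \<and> j = v then z else 0) - (if i = v \<and> j = u then cnj z else 0)"
  by (auto simp: pair_mat_def unit_mat_def)

lemma pair_mat_lincomb:
  "pair_mat u v (complex_of_real a * y + complex_of_real b * z)
     = rscale a (pair_mat u v y) + rscale b (pair_mat u v z)"
proof -
  have "unit_mat p q (complex_of_real a * y + complex_of_real b * z)
      = rscale a (unit_mat p q y) + rscale b (unit_mat p q z)" for p q :: 'a and y z :: complex
    by (simp add: fun_eq_iff unit_mat_def)
  then show ?thesis
    by (simp add: pair_mat_def cm.scale_right_diff_distrib)
qed

lemma mmul_unit_mat:
  assumes "finite S" "v \<in> S"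
  shows "mmul S (unit_mat u v y) (unit_mat v' w z) = (if v = v' then unit_mat u w (y * z) else 0)"
proof -
  have "mmul S (unit_mat u v y) (unit_mat v' w z) i j
      = (\<Sum>k\<in>S. if k = v then if v = v' \<and> i = u \<and> j = w then y * z else 0 else 0)" for i j
    unfolding mmul_def by (intro sum.cong refl) (auto simp: unit_mat_def)
  then show ?thesis using assms by (auto simp: fun_eq_iff unit_mat_def)
qed

lemma bracket_pair_mat:
  assumes "finite S" "u \<in> S" "v \<in> S" "w \<in> S" "u \<noteq> v" "v \<noteq> w" "u \<noteq> w"
  shows "bracket S (pair_mat u v z) (pair_mat v w 1) = pair_mat u w z"
  using assms unfolding bracket_eq pair_mat_def mmul_simps by (simp add: mmul_unit_mat)

lemma bracket_pair_mat_diag: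
  assumes "finite S" "u \<in> S" "v \<in> S" "u \<noteq> v"
  shows "bracket S (pair_mat u v 1) (pair_mat u v \<i>) = unit_mat u u (2 * \<i>) - unit_mat v v (2 * \<i>)"
  using assms unfolding bracket_eq pair_mat_def mmul_simps
  by (simp add: mmul_unit_mat) (auto simp: fun_eq_iff unit_mat_def)

lemma bracket_diag_mat:
  assumes "finite S" "\<And>i j. i \<notin> S \<or> j \<notin> S \<Longrightarrow> A i j = 0"
  shows "bracket S (diag_mat S d) A = (\<lambda>i j. \<i> * complex_of_real (d i - d j) * A i j)"
proof -
  have "mmul S (diag_mat S d) A i j = \<i> * complex_of_real (d i) * A i j" for i j
  proof -
    have "mmul S (diag_mat S d) A i j = (\<Sum>k\<in>S. if k = i then \<i> * complex_of_real (d i) * A i j else 0)"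
      unfolding mmul_def by (intro sum.cong refl) (auto simp: diag_mat_def)
    then show ?thesis using assms by auto
  qed
  moreover have "mmul S A (diag_mat S d) i j = \<i> * complex_of_real (d j) * A i j" for i j
  proof -
    have "mmul S A (diag_mat S d) i j = (\<Sum>k\<in>S. if k = j then \<i> * complex_of_real (d j) * A i j else 0)"
      unfolding mmul_def by (intro sum.cong refl) (auto simp: diag_mat_def)
    then show ?thesis using assms by auto
  qed
  ultimately show ?thesis by (simp add: bracket_def fun_eq_iff algebra_simps)
qed

lemma pair_mat_traceless_skew:
  assumes "u \<in> S" "v \<in> S" "u \<noteq> v"
  shows "pair_mat u v z \<in> traceless_skew S"
proof -
  have "pair_mat u v z \<in> skew S"
    using assms by (intro skewI) (auto simp: pair_mat_apply)
  then show ?thesis using assms by (auto simp: traceless_skew_def pair_mat_apply intro!: sum.neutral)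
qed

lemma diag_mat_skew: "diag_mat S d \<in> skew S"
  by (intro skewI) (auto simp: diag_mat_def)

lemma diag_mat_traceless_skew:
  assumes "(\<Sum>i\<in>S. d i) = 0"
  shows "diag_mat S d \<in> traceless_skew S"
proof -
  have "(\<Sum>i\<in>S. diag_mat S d i i) = \<i> * complex_of_real (\<Sum>i\<in>S. d i)"
    unfolding of_real_sum sum_distrib_left by (intro sum.cong) (auto simp: diag_mat_def)
  then show ?thesis using assms diag_mat_skew by (simp add: traceless_skew_def)
qed

lemma sum_sum_delta:
  fixes f :: "'a \<Rightarrow> 'a \<Rightarrow> complex"
  assumes "finite S"
  shows "(\<Sum>u\<in>S. \<Sum>v\<in>S. if u = i \<and> v = j then f u v else 0) = (if i \<in> S \<and> j \<in> S then f i j else 0)"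
proof -
  have "(\<Sum>v\<in>S. if u = i \<and> v = j then f u v else 0) = (if u = i then if j \<in> S then f i j else 0 else 0)" for u
    using assms by (cases "u = i") simp_all
  then show ?thesis using assms by simp
qed

text \<open>Summing over ordered pairs meets each position twice, once from each order, whence the
  factor 2. This avoids choosing an order on the indices.\<close>

lemma skew_pair_decomp:
  assumes fin: "finite S" and A: "A \<in> skew S"
  shows "rscale 2 A = (\<Sum>u\<in>S. \<Sum>v\<in>S. pair_mat u v (A u v))"
proof -
  have "rscale 2 A i j = (\<Sum>u\<in>S. \<Sum>v\<in>S. pair_mat u v (A u v) i j)" for i j
  proof -
    have "pair_mat u v (A u v) i j = (if u = i \<and> v = j then A u v else 0)
        - (if u = j \<and> v = i then cnj (A u v) else 0)" for u v
      unfolding pair_mat_apply by (cases "u = i"; cases "v = j"; cases "u = j"; cases "v = i") simp_all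
    then have "(\<Sum>u\<in>S. \<Sum>v\<in>S. pair_mat u v (A u v) i j)
      = (\<Sum>u\<in>S. \<Sum>v\<in>S. if u = i \<and> v = j then A u v else 0)
        - (\<Sum>u\<in>S. \<Sum>v\<in>S. if u = j \<and> v = i then cnj (A u v) else 0)"
      by (simp only: sum_subtractf)
    also have "\<dots> = (if i \<in> S \<and> j \<in> S then A i j - cnj (A j i) else 0)"
      by (simp only: sum_sum_delta[OF fin]) simp
    also have "\<dots> = 2 * A i j"
      using skew_outside[OF A, of i j] by (simp add: skew_cnj[OF A])
    finally show ?thesis by simp
  qed
  then show ?thesis by (simp add: fun_eq_iff sum_fun_apply)
qed

text \<open>Brackets with diagonal matrices isolate one off-diagonal pair from a nonzero element of
  \<open>J\<close>. Brackets of pairs then reach every other pair, and two pairs at the same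
  position produce the diagonal differences, which complete su.\<close>

lemma traceless_skew_simple:
  assumes fin: "finite V" and sub: "cm.subspace J" and JV: "J \<subseteq> traceless_skew V"
    and ideal: "\<And>A B. A \<in> traceless_skew V \<Longrightarrow> B \<in> J \<Longrightarrow> bracket V A B \<in> J"
    and A: "A \<in> J" "A \<noteq> 0"
  shows "J = traceless_skew V"
proof -
  note J_scale = cm.subspace_scale[OF sub] and J_neg = cm.subspace_neg[OF sub]
    and J_add = cm.subspace_add[OF sub]
  have J_scale_iff: "A \<in> J" if "rscale r A \<in> J" "r \<noteq> 0" for r and A :: "'a cmat"
    using J_scale[OF that(1), of "1 / r"] that(2) by simp
  have J_skew: "B \<in> skew V" if "B \<in> J" for B
    using that JV by (auto simp: traceless_skew_def)
  have J_diag: "(\<lambda>i j. \<i> * complex_of_real (d i - d j) * B i j) \<in> J" if B: "B \<in> J" for B d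
  proof -
    \<comment> \<open>Subtracting the mean makes the diagonal matrix traceless, and the bracket sees
      only differences of \<open>d\<close>, so every \<open>d\<close> becomes admissible.\<close>
    let ?d = "\<lambda>i. d i - (\<Sum>i\<in>V. d i) / real (card V)"
    have "(\<Sum>i\<in>V. ?d i) = 0"
      using fin by (cases "V = {}") (simp_all add: sum_subtractf)
    then have "diag_mat V ?d \<in> traceless_skew V" by (rule diag_mat_traceless_skew)
    then have "bracket V (diag_mat V ?d) B \<in> J" using ideal B by blast
    moreover have "bracket V (diag_mat V ?d) B = (\<lambda>i j. \<i> * complex_of_real (?d i - ?d j) * B i j)"
      using skew_outside[OF J_skew[OF B]] by (intro bracket_diag_mat fin)
    ultimately show ?thesis by simp
  qed
  have J_pair: "pair_mat u v (B u v) \<in> J" if B: "B \<in> J" and uv: "u \<noteq> v" for B u v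
  proof -
    \<comment> \<open>Applying \<open>dd u\<close> twice multiplies an entry by -1 if exactly one of
      its indices is \<open>u\<close> and by 0 otherwise. Doing so for \<open>u\<close> and for
      \<open>v\<close> keeps exactly the entries at \<open>(u, v)\<close> and \<open>(v, u)\<close>,
      with sign +1.\<close>
    define dd where "dd u C = (\<lambda>i j. \<i> * complex_of_real ((if i = u then 1 else 0) - (if j = u then 1 else 0)) * C i j)"
      for u :: 'a and C :: "'a cmat"
    have "dd v (dd v (dd u (dd u B))) \<in> J"
      unfolding dd_def by (intro J_diag B)
    moreover have "dd v (dd v (dd u (dd u B))) i j = pair_mat u v (B u v) i j" for i j
      using uv skew_cnj[OF J_skew[OF B], of u v]
      by (cases "i = u"; cases "i = v"; cases "j = u"; cases "j = v")
        (simp_all add: dd_def pair_mat_apply)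
    ultimately show ?thesis by (metis ext)
  qed
  have A_skew: "A \<in> skew V" using A(1) by (rule J_skew)
  obtain u v z where uv: "u \<in> V" "v \<in> V" "u \<noteq> v" and z: "z \<noteq> 0" "pair_mat u v z \<in> J"
  proof (cases "\<exists>u v. u \<noteq> v \<and> A u v \<noteq> 0")
    case True
    then obtain u v where "u \<noteq> v" "A u v \<noteq> 0" by blast
    then show ?thesis using that[of u v "A u v"] J_pair[OF A(1)] skew_outside[OF A_skew] by blast
  next
    case False
    obtain u where u: "A u u \<noteq> 0" using False A(2) by (metis ext zero_fun_apply)
    then have uV: "u \<in> V" using skew_outside[OF A_skew] by blast
    have tr: "(\<Sum>i\<in>V. A i i) = 0" using A(1) JV by (auto simp: traceless_skew_def)
    \<comment> \<open>Here \<open>A\<close> is diagonal. A nonzero traceless diagonal cannot be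
      constant, so two entries differ, and the bracket with a pair matrix moves their difference to
      an off-diagonal position.\<close>
    obtain v where v: "v \<in> V" "A v v \<noteq> A u u"
    proof (rule ccontr)
      assume "\<not> thesis"
      then have "\<forall>v\<in>V. A v v = A u u" using that by blast
      then have "(\<Sum>i\<in>V. A i i) = of_nat (card V) * A u u" by simp
      then show False using tr u uV fin by auto
    qed
    have "u \<noteq> v" using v(2) by auto
    with uV v(1) have "pair_mat u v 1 \<in> traceless_skew V" by (rule pair_mat_traceless_skew)
    then have "bracket V (pair_mat u v 1) A \<in> J" using A(1) by (rule ideal)
    from J_pair[OF this \<open>u \<noteq> v\<close>]
    have "pair_mat u v (bracket V (pair_mat u v 1) A u v) \<in> J" .
    moreover have "bracket V (pair_mat u v 1) A u v = A v v - A u u"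
    proof -
      have "mmul V (pair_mat u v 1) A u v = (\<Sum>k\<in>V. if k = v then A v v else 0)"
        unfolding mmul_def using \<open>u \<noteq> v\<close> by (intro sum.cong) (auto simp: pair_mat_apply)
      moreover have "mmul V A (pair_mat u v 1) u v = (\<Sum>k\<in>V. if k = u then A u u else 0)"
        unfolding mmul_def using \<open>u \<noteq> v\<close> by (intro sum.cong) (auto simp: pair_mat_apply)
      ultimately show ?thesis using fin uV v(1) by (simp add: bracket_def)
    qed
    ultimately show ?thesis using that[of u v "A v v - A u u"] uV v \<open>u \<noteq> v\<close> by simp
  qed
  define K where "K p q \<longleftrightarrow> p \<in> V \<and> q \<in> V \<and> p \<noteq> q \<and> (\<forall>y. pair_mat p q y \<in> J)" for p q
  \<comment> \<open>A diagonal bracket turns the coefficient \<open>z\<close> into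
    \<open>\<i> * z\<close>; as \<open>z\<close> is nonzero, these two span the complex numbers over
    the reals.\<close>
  have K_uv: "K u v"
  proof -
    have "(\<lambda>i j. \<i> * complex_of_real ((if i = u then 1 else 0) - (if j = u then 1 else 0)) * pair_mat u v z i j) \<in> J"
      by (rule J_diag[OF z(2)])
    moreover have "(\<lambda>i j. \<i> * complex_of_real ((if i = u then 1 else 0) - (if j = u then 1 else 0)) * pair_mat u v z i j)
        = pair_mat u v (\<i> * z)"
      using uv(3) by (auto simp: fun_eq_iff pair_mat_apply)
    ultimately have iz: "pair_mat u v (\<i> * z) \<in> J" by simp
    have "pair_mat u v y \<in> J" for y
    proof -
      have "pair_mat u v y = rscale (Re (y / z)) (pair_mat u v z) + rscale (Im (y / z)) (pair_mat u v (\<i> * z))"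
      proof -
        define c where "c = y / z"
        have y: "y = complex_of_real (Re c) * z + complex_of_real (Im c) * (\<i> * z)"
        proof -
          have "complex_of_real (Re c) * z + complex_of_real (Im c) * (\<i> * z)
              = (complex_of_real (Re c) + \<i> * complex_of_real (Im c)) * z"
            by (simp add: algebra_simps)
          also have "\<dots> = c * z" by (simp only: complex_eq[symmetric])
          finally show ?thesis using z(1) by (simp add: c_def)
        qed
        show ?thesis unfolding c_def[symmetric] pair_mat_lincomb[symmetric] y[symmetric] ..
      qed
      then show ?thesis using J_add[OF J_scale[OF z(2)] J_scale[OF iz]] by simp
    qed
    then show ?thesis using uv by (simp add: K_def)
  qed
  have K_sym: "K q p" if "K p q" for p q
  proof -
    have "pair_mat q p y = - pair_mat p q (cnj y)" for y
      by (simp add: pair_mat_def)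
    then show ?thesis using that J_neg by (auto simp: K_def)
  qed
  have K_step: "K p w" if "K p q" "w \<in> V" "w \<noteq> p" for p q w
  proof (cases "w = q")
    case False
    have "pair_mat p w y \<in> J" for y
    proof -
      have "bracket V (pair_mat q w 1) (pair_mat p q y) \<in> J"
        using that False by (intro ideal pair_mat_traceless_skew) (auto simp: K_def)
      then have "- bracket V (pair_mat q w 1) (pair_mat p q y) \<in> J" by (rule J_neg)
      then have "bracket V (pair_mat p q y) (pair_mat q w 1) \<in> J"
        using bracket_anticomm by metis
      moreover have "bracket V (pair_mat p q y) (pair_mat q w 1) = pair_mat p w y"
        using that False fin by (intro bracket_pair_mat) (auto simp: K_def)
      ultimately show ?thesis by simp
    qed
    then show ?thesis using that by (auto simp: K_def)
  qed (use that in simp)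
  have K_all: "K p q" if "p \<in> V" "q \<in> V" "p \<noteq> q" for p q
  proof (cases "p = u")
    case True
    then show ?thesis using K_step[OF K_uv] that by blast
  next
    case False
    then have "K p u" using K_step[OF K_uv] K_sym that by blast
    then show ?thesis using K_step that by blast
  qed
  \<comment> \<open>Diagonal elements are measured against the fixed index \<open>u\<close>.\<close>
  have J_units: "unit_mat p p c - unit_mat u u c \<in> J" if p: "p \<in> V" and c: "Re c = 0" for p c
  proof (cases "p = u")
    case True
    then show ?thesis using cm.subspace_0[OF sub] by simp
  next
    case False
    have "bracket V (pair_mat p u 1) (pair_mat p u \<i>) \<in> J"
      using K_all[OF p uv(1) False] False p uv(1)
      by (intro ideal pair_mat_traceless_skew) (auto simp: K_def)
    then have "rscale (Im c / 2) (unit_mat p p (2 * \<i>) - unit_mat u u (2 * \<i>)) \<in> J"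
      using bracket_pair_mat_diag[OF fin p uv(1) False] J_scale by simp
    moreover have "c = complex_of_real (Im c / 2) * (2 * \<i>)"
      using c by (simp add: complex_eq_iff)
    then have "rscale (Im c / 2) (unit_mat p p (2 * \<i>) - unit_mat u u (2 * \<i>))
        = unit_mat p p c - unit_mat u u c"
      by (auto simp: fun_eq_iff unit_mat_def)
    ultimately show ?thesis by simp
  qed
  have "B \<in> J" if B: "B \<in> traceless_skew V" for B
  proof -
    have B_skew: "B \<in> skew V" and tr: "(\<Sum>i\<in>V. B i i) = 0"
      using B by (auto simp: traceless_skew_def)
    \<comment> \<open>Each diagonal entry is compensated at \<open>u\<close> to give an element
      covered by \<open>J_units\<close>; the compensations add up to twice the trace of
      \<open>B\<close> and hence cancel.\<close>
    define t where "t p q = pair_mat p q (B p q) - (if p = q then unit_mat u u (2 * B p p) else 0)" for p q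
    have t_J: "t p q \<in> J" if pq: "p \<in> V" "q \<in> V" for p q
    proof (cases "p = q")
      case True
      have "cnj (B p p) = - B p p" using B_skew by (rule skew_cnj)
      then have "Re (2 * B p p) = 0" "pair_mat p p (B p p) = unit_mat p p (2 * B p p)"
        by (auto simp: complex_eq_iff fun_eq_iff pair_mat_apply unit_mat_def)
      then show ?thesis using J_units[OF pq(1), of "2 * B p p"] True by (simp add: t_def)
    next
      case False
      then show ?thesis using K_all[OF pq] by (simp add: t_def K_def)
    qed
    have "(\<Sum>p\<in>V. \<Sum>q\<in>V. t p q) = rscale 2 B - (\<Sum>p\<in>V. unit_mat u u (2 * B p p))"
      unfolding skew_pair_decomp[OF fin B_skew] t_def sum_subtractf using fin by simp
    moreover have "(\<Sum>p\<in>V. unit_mat u u (2 * B p p)) = 0"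
    proof -
      have "(\<Sum>p\<in>V. unit_mat u u (2 * B p p)) i j = 0 i j" for i j
        using tr by (cases "i = u \<and> j = u") (auto simp: sum_fun_apply unit_mat_def sum_distrib_left[symmetric])
      then show ?thesis by (intro ext)
    qed
    ultimately have "rscale 2 B = (\<Sum>p\<in>V. \<Sum>q\<in>V. t p q)" by simp
    moreover have "(\<Sum>p\<in>V. \<Sum>q\<in>V. t p q) \<in> J"
      by (intro cm.subspace_sum[OF sub] t_J)
    ultimately have "rscale 2 B \<in> J" by simp
    then show ?thesis by (rule J_scale_iff) simp
  qed
  then show ?thesis using JV by blast
qed

section \<open>Generating the skew-Hermitian matrices\<close>

definition outer :: "('z \<Rightarrow> complex) \<Rightarrow> ('z \<Rightarrow> complex) \<Rightarrow> 'z cmat" where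
  "outer x y = (\<lambda>i j. x i * cnj (y j))"

definition vip :: "'z set \<Rightarrow> ('z \<Rightarrow> complex) \<Rightarrow> ('z \<Rightarrow> complex) \<Rightarrow> complex" where
  "vip S x y = (\<Sum>k\<in>S. cnj (x k) * y k)"

definition wedge :: "('z \<Rightarrow> complex) \<Rightarrow> ('z \<Rightarrow> complex) \<Rightarrow> 'z cmat" where
  "wedge x y = outer x y - outer y x"

lemma wedge_apply: "wedge x y i j = x i * cnj (y j) - y i * cnj (x j)"
  by (simp add: wedge_def outer_def)

lemma mmul_outer: "mmul S (outer x y) (outer z w) = (\<lambda>i j. vip S y z * outer x w i j)"
  by (simp add: mmul_def outer_def vip_def fun_eq_iff sum_distrib_left sum_distrib_right mult_ac)

lemma cnj_vip: "cnj (vip S x y) = vip S y x"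
  by (simp add: vip_def mult.commute)

text \<open>Read from right to left, this expresses \<open>wedge x y\<close> through a bracket and
  wedges with \<open>p\<close>. The factor \<open>(vip S x y - vip S y x) / 2\<close> is the
  imaginary part of the inner product, times \<open>\<i>\<close>.\<close>

lemma bracket_wedge_wedge:
  "bracket S (wedge x p) (wedge y p) =
     - rscale (Re (vip S p p)) (wedge x y) + wedge (\<lambda>k. vip S p y * x k) p
     - wedge (\<lambda>k. vip S p x * y k) p - wedge (\<lambda>k. (vip S x y - vip S y x) / 2 * p k) p"
proof -
  have pp: "complex_of_real (Re (vip S p p)) = vip S p p"
    using cnj_vip[of S p p] by (metis Reals_cnj_iff of_real_Re)
  show ?thesis
    unfolding bracket_eq wedge_def mmul_simps mmul_outer
    by (simp add: fun_eq_iff pp cnj_vip) (simp add: outer_def cnj_vip field_simps)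
qed

text \<open>The left factor is \<open>2 * \<i>\<close> times the unnormalised projection onto
  \<open>p\<close>. Up to a real multiple of \<open>wedge (\<lambda>k. \<i> * p k) p\<close>,
  bracketing with it replaces \<open>x\<close> by a real multiple of \<open>\<i> * x\<close>, which
  supplies the complex structure.\<close>

lemma bracket_proj_wedge:
  "bracket S (wedge (\<lambda>k. \<i> * p k) p) (wedge x p) =
     rscale 2 (wedge (\<lambda>k. \<i> * (vip S p x + vip S x p) / 2 * p k) p - rscale (Re (vip S p p)) (wedge (\<lambda>k. \<i> * x k) p))"
proof -
  have pp: "complex_of_real (Re (vip S p p)) = vip S p p"
    using cnj_vip[of S p p] by (metis Reals_cnj_iff of_real_Re)
  have v: "vip S (\<lambda>k. \<i> * p k) z = - \<i> * vip S p z" "vip S z (\<lambda>k. \<i> * p k) = \<i> * vip S z p" for z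
    by (simp_all add: vip_def sum_distrib_left mult_ac sum_negf)
  show ?thesis
    unfolding bracket_eq wedge_def mmul_simps mmul_outer
    by (simp add: fun_eq_iff pp v cnj_vip) (simp add: outer_def cnj_vip field_simps)
qed

text \<open>Writing \<open>x y\<^sup>\<dagger> - y x\<^sup>\<dagger>\<close> for \<open>wedge x y\<close>, the vectors whose wedge with \<open>p\<close>
  lies in the algebra form a complex subspace stable under the diagonal matrix \<open>d\<close>; since \<open>p\<close> is a
  cyclic vector of \<open>d\<close>, this subspace is everything.\<close>
lemma skew_subset_lie_closed:
  fixes d :: "'v \<Rightarrow> real"
  assumes fin: "finite V" and sub: "cm.subspace G" and lie: "lie_closed V G"
    and diag: "\<And>a. a \<in> G \<Longrightarrow> (\<lambda>i j. \<i> * complex_of_real (d i - d j) * a i j) \<in> G"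
    and inj: "inj_on d V"
    and gen: "wedge (\<lambda>k. \<i> * p k) p \<in> G"
    and p: "\<And>u. u \<in> V \<Longrightarrow> p u \<noteq> 0" "\<And>u. u \<notin> V \<Longrightarrow> p u = 0"
  shows "skew V \<subseteq> G"
proof (cases "V = {}")
  case True
  then have "A = 0" if "A \<in> skew V" for A
    using skew_outside[OF that] by (auto simp: fun_eq_iff)
  then show ?thesis using cm.subspace_0[OF sub] by blast
next
  case False
  define n where "n = Re (vip V p p)"
  have "n = (\<Sum>k\<in>V. (cmod (p k))\<^sup>2)"
    unfolding n_def vip_def Re_sum by (intro sum.cong refl) (simp add: cmod_power2, simp add: power2_eq_square)
  then have n: "n > 0"
    using fin False p(1) by (simp add: sum_pos)
  note G_add = cm.subspace_add[OF sub] and G_diff = cm.subspace_diff[OF sub]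
    and G_scale = cm.subspace_scale[OF sub] and G_neg = cm.subspace_neg[OF sub]
  have G_scale_iff: "A \<in> G" if "rscale r A \<in> G" "r \<noteq> 0" for r and A :: "'v cmat"
    using G_scale[OF that(1), of "1 / r"] that(2) by simp
  define Q where "Q = {x. wedge x p \<in> G}"
  have Q_add: "(\<lambda>k. x k + y k) \<in> Q" if "x \<in> Q" "y \<in> Q" for x y
  proof -
    have "wedge (\<lambda>k. x k + y k) p = wedge x p + wedge y p"
      by (simp add: fun_eq_iff wedge_apply algebra_simps)
    then show ?thesis using that G_add by (simp add: Q_def)
  qed
  have Q_real: "(\<lambda>k. complex_of_real r * x k) \<in> Q" if "x \<in> Q" for x r
  proof -
    have "wedge (\<lambda>k. complex_of_real r * x k) p = rscale r (wedge x p)"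
      by (simp add: fun_eq_iff wedge_apply algebra_simps)
    then show ?thesis using that G_scale by (simp add: Q_def)
  qed
  have ip: "(\<lambda>k. \<i> * p k) \<in> Q" using gen by (simp add: Q_def)
  have Q_i: "(\<lambda>k. \<i> * x k) \<in> Q" if x: "x \<in> Q" for x
  proof -
    have br: "bracket V (wedge (\<lambda>k. \<i> * p k) p) (wedge x p) \<in> G"
      using lie gen x by (simp add: lie_closed_def Q_def)
    have r: "complex_of_real (Re (vip V p x)) = (vip V p x + vip V x p) / 2"
      using complex_add_cnj[of "vip V p x"] by (simp add: cnj_vip)
    have "(\<lambda>k. complex_of_real (Re (vip V p x)) * (\<i> * p k)) \<in> Q"
      by (rule Q_real[OF ip])
    then have "wedge (\<lambda>k. \<i> * (vip V p x + vip V x p) / 2 * p k) p \<in> G"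
      unfolding r Q_def by (simp add: mult_ac)
    moreover have "wedge (\<lambda>k. \<i> * (vip V p x + vip V x p) / 2 * p k) p - rscale n (wedge (\<lambda>k. \<i> * x k) p) \<in> G"
      using br unfolding bracket_proj_wedge n_def[symmetric] by (rule G_scale_iff) simp
    ultimately have "rscale n (wedge (\<lambda>k. \<i> * x k) p) \<in> G"
      using G_diff by fastforce
    then show ?thesis unfolding Q_def mem_Collect_eq using n by (rule G_scale_iff[OF _ less_imp_neq[symmetric]])
  qed
  have Q_scale: "(\<lambda>k. c * x k) \<in> Q" if x: "x \<in> Q" for x c
  proof -
    have "(\<lambda>k. complex_of_real (Re c) * x k + complex_of_real (Im c) * (\<i> * x k)) \<in> Q"
      using x by (intro Q_add Q_real Q_i)
    moreover have "complex_of_real (Re c) * z + complex_of_real (Im c) * (\<i> * z) = c * z" for z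
      by (simp add: complex_eq_iff algebra_simps)
    ultimately show ?thesis by simp
  qed
  have p_Q: "p \<in> Q"
    using Q_scale[OF ip, of "- \<i>"] by simp
  have wedge_G: "wedge x y \<in> G" if x: "x \<in> Q" and y: "y \<in> Q" for x y
  proof -
    have br: "bracket V (wedge x p) (wedge y p) \<in> G"
      using lie x y by (simp add: lie_closed_def Q_def)
    have "wedge (\<lambda>k. vip V p y * x k) p \<in> G" "wedge (\<lambda>k. vip V p x * y k) p \<in> G"
      "wedge (\<lambda>k. (vip V x y - vip V y x) / 2 * p k) p \<in> G"
      using Q_scale[OF x] Q_scale[OF y] Q_scale[OF p_Q] by (simp_all only: Q_def mem_Collect_eq)
    with br have "bracket V (wedge x p) (wedge y p) - wedge (\<lambda>k. vip V p y * x k) p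
       + wedge (\<lambda>k. vip V p x * y k) p + wedge (\<lambda>k. (vip V x y - vip V y x) / 2 * p k) p \<in> G"
      by (intro G_add G_diff)
    then have "rscale (- n) (wedge x y) \<in> G"
      unfolding bracket_wedge_wedge n_def by simp
    then show ?thesis by (rule G_scale_iff) (use n in simp)
  qed
  \<comment> \<open>The diagonal bracket acts on a wedge by the Leibniz rule, so it also
    differentiates \<open>p\<close>. The extra term is a wedge of two vectors of \<open>Q\<close>
    once \<open>dp_Q\<close> is known, and \<open>wedge_G\<close> then removes it.\<close>
  have diag_wedge: "wedge (\<lambda>k. \<i> * complex_of_real (d k) * x k) p
      - wedge (\<lambda>k. \<i> * x k) (\<lambda>k. complex_of_real (d k) * p k) \<in> G" if "x \<in> Q" for x
  proof -
    have "wedge (\<lambda>k. \<i> * complex_of_real (d k) * x k) p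
      - wedge (\<lambda>k. \<i> * x k) (\<lambda>k. complex_of_real (d k) * p k)
      = (\<lambda>i j. \<i> * complex_of_real (d i - d j) * wedge x p i j)"
      by (simp add: fun_eq_iff wedge_apply algebra_simps)
    then show ?thesis using diag that by (simp add: Q_def)
  qed
  have dp_Q: "(\<lambda>k. complex_of_real (d k) * p k) \<in> Q"
  proof -
    have "rscale (- 2) (wedge (\<lambda>k. complex_of_real (d k) * p k) p)
      = (\<lambda>i j. \<i> * complex_of_real (d i - d j) * wedge (\<lambda>k. \<i> * p k) p i j)"
      by (simp add: fun_eq_iff wedge_apply algebra_simps)
    then have "rscale (- 2) (wedge (\<lambda>k. complex_of_real (d k) * p k) p) \<in> G"
      using diag[OF gen] by simp
    then show ?thesis unfolding Q_def mem_Collect_eq by (rule G_scale_iff) simp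
  qed
  have Q_diag: "(\<lambda>k. complex_of_real (d k) * x k) \<in> Q" if x: "x \<in> Q" for x
  proof -
    have "wedge (\<lambda>k. \<i> * complex_of_real (d k) * x k) p \<in> G"
      using G_add[OF diag_wedge[OF x] wedge_G[OF Q_i[OF x] dp_Q]] by simp
    then have "(\<lambda>k. \<i> * complex_of_real (d k) * x k) \<in> Q" by (simp add: Q_def)
    from Q_scale[OF this, of "- \<i>"] show ?thesis by (simp add: mult_ac)
  qed
  \<comment> \<open>Polynomials in \<open>d\<close> applied to \<open>p\<close>, in the factored
    form needed for Lagrange interpolation.\<close>
  have Q_prod: "(\<lambda>k. complex_of_real (\<Prod>w\<in>F. d k - d w) * p k) \<in> Q" if "finite F" for F
    using that
  proof (induction F rule: finite_induct)
    case empty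
    then show ?case using p_Q by simp
  next
    case (insert w F)
    let ?x = "\<lambda>k. complex_of_real (\<Prod>w\<in>F. d k - d w) * p k"
    have "(\<lambda>k. complex_of_real (d k) * ?x k + complex_of_real (- d w) * ?x k) \<in> Q"
      using insert.IH by (intro Q_add Q_diag Q_real)
    moreover have "complex_of_real (d k) * ?x k + complex_of_real (- d w) * ?x k
        = complex_of_real (\<Prod>w\<in>insert w F. d k - d w) * p k" for k
      using insert.hyps by (simp add: algebra_simps)
    ultimately show ?case by simp
  qed
  define e where "e u = (\<lambda>k::'v. if k = u then 1 else 0 :: complex)" for u
  have e_Q: "e u \<in> Q" if u: "u \<in> V" for u
  proof -
    \<comment> \<open>The product over the other indices vanishes at each of them; at
      \<open>u\<close> it is nonzero since \<open>d\<close> is injective, and so is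
      \<open>p u\<close>. This isolates a multiple of the basis vector \<open>e u\<close>.\<close>
    define c where "c = complex_of_real (\<Prod>w\<in>V - {u}. d u - d w) * p u"
    have "c \<noteq> 0"
      using u p(1) inj fin by (auto simp: c_def inj_on_def)
    have "complex_of_real (\<Prod>w\<in>V - {u}. d k - d w) * p k = c * e u k" for k
    proof (cases "k = u \<or> k \<notin> V")
      case True
      then show ?thesis using u p(2) by (auto simp: e_def c_def)
    next
      case False
      then have "(\<Prod>w\<in>V - {u}. d k - d w) = 0"
        using fin by (intro prod_zero) auto
      then show ?thesis using False by (simp add: e_def)
    qed
    then have "(\<lambda>k. c * e u k) \<in> Q" using Q_prod[of "V - {u}"] fin by simp
    from Q_scale[OF this, of "1 / c"] show ?thesis using \<open>c \<noteq> 0\<close> by simp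
  qed
  show ?thesis
  proof
    fix A assume A: "A \<in> skew V"
    have "rscale 2 A = (\<Sum>u\<in>V. \<Sum>v\<in>V. wedge (\<lambda>k. A u v * e u k) (e v))"
      unfolding skew_pair_decomp[OF fin A] pair_mat_def unit_mat_def
      by (intro sum.cong refl) (auto simp: fun_eq_iff wedge_apply e_def)
    moreover have "(\<Sum>u\<in>V. \<Sum>v\<in>V. wedge (\<lambda>k. A u v * e u k) (e v)) \<in> G"
      by (intro cm.subspace_sum[OF sub] wedge_G Q_scale e_Q)
    ultimately have "rscale 2 A \<in> G" by simp
    then show "A \<in> G" by (rule G_scale_iff) simp
  qed
qed

section \<open>The Lie algebra of the QWOA\<close>

lemma wedge_skew:
  assumes "\<And>i. i \<notin> S \<Longrightarrow> x i = 0" "\<And>i. i \<notin> S \<Longrightarrow> y i = 0"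
  shows "wedge x y \<in> skew S"
proof (rule skewI)
  show "wedge x y i j = 0" if "i \<notin> S \<or> j \<notin> S" for i j
    using that assms[of i] assms[of j] by (auto simp: wedge_apply)
  show "wedge x y j i = - cnj (wedge x y i j)" for i j
    by (simp add: wedge_apply)
qed

lemma bracket_0: "bracket S 0 B = 0"
  by (intro ext) (simp add: bracket_def mmul_def)

lemma hs_diag_mat:
  assumes "finite S"
  shows "hs S (diag_mat S d) (diag_mat S d) = complex_of_real (\<Sum>i\<in>S. (d i)\<^sup>2)"
proof -
  have "(\<Sum>j\<in>S. cnj (diag_mat S d i j) * diag_mat S d i j) = complex_of_real ((d i)\<^sup>2)" if "i \<in> S" for i
  proof -
    have "(\<Sum>j\<in>S. cnj (diag_mat S d i j) * diag_mat S d i j)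
        = (\<Sum>j\<in>S. if j = i then complex_of_real ((d i)\<^sup>2) else 0)"
      using that by (intro sum.cong) (auto simp: diag_mat_def power2_eq_square mult_ac)
    then show ?thesis using assms that by simp
  qed
  then show ?thesis unfolding hs_def of_real_sum by (intro sum.cong) auto
qed

text \<open>\<open>lift a\<close> is the matrix on \<open>S\<close> that acts on the normalised uniform superpositions over the
  classes of \<open>C\<close> as \<open>a\<close> does on the standard basis; \<open>w u\<close> is the norm of the indicator of the
  class \<open>u\<close>.\<close>
locale value_classes =
  fixes S :: "'z set" and C :: "'z \<Rightarrow> int"
  assumes fin: "finite S"
begin

definition w :: "int \<Rightarrow> real" where
  "w u = sqrt (real (card {i \<in> S. C i = u}))"

definition lift :: "int cmat \<Rightarrow> 'z cmat" where
  "lift a = (\<lambda>i j. if i \<in> S \<and> j \<in> S then a (C i) (C j) / complex_of_real (w (C i) * w (C j)) else 0)"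

abbreviation V :: "int set" where "V \<equiv> C ` S"

lemma finV: "finite V"
  using fin by simp

lemma w_pos: "u \<in> V \<Longrightarrow> w u > 0"
  using fin by (auto simp: w_def card_gt_0_iff)

lemma w_nz: "i \<in> S \<Longrightarrow> w (C i) \<noteq> 0"
  using w_pos[of "C i"] by auto

lemma w_outside:
  assumes "u \<notin> V"
  shows "w u = 0"
proof -
  have "{i \<in> S. C i = u} = {}" using assms by blast
  then show ?thesis by (simp only: w_def card.empty of_nat_0 real_sqrt_zero)
qed

lemma w_square: "w u * w u = real (card {i \<in> S. C i = u})"
  by (simp add: w_def)

lemma sum_w_square: "(\<Sum>u\<in>V. w u * w u) = real (card S)"
proof -
  have "real (card S) = (\<Sum>i\<in>S. 1)" by simp
  also have "\<dots> = (\<Sum>u\<in>V. \<Sum>i\<in>{i \<in> S. C i = u}. 1)"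
    by (rule sum.image_gen[OF fin])
  finally show ?thesis by (simp add: w_square)
qed

text \<open>\<open>w u * w u\<close> is the size of the class, so dividing by it gives each class
  total weight one. This makes \<open>lift\<close> multiplicative and isometric.\<close>

lemma sum_classes:
  fixes f :: "int \<Rightarrow> complex"
  shows "(\<Sum>k\<in>S. f (C k) / complex_of_real (w (C k) * w (C k))) = (\<Sum>u\<in>V. f u)"
proof -
  have "(\<Sum>k\<in>S. f (C k) / complex_of_real (w (C k) * w (C k)))
      = (\<Sum>u\<in>V. \<Sum>k\<in>{k \<in> S. C k = u}. f (C k) / complex_of_real (w (C k) * w (C k)))"
    by (rule sum.image_gen[OF fin])
  also have "\<dots> = (\<Sum>u\<in>V. f u)"
  proof (rule sum.cong[OF refl])
    fix u assume "u \<in> V"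
    then have "card {k \<in> S. C k = u} \<noteq> 0" using fin by auto
    then show "(\<Sum>k\<in>{k \<in> S. C k = u}. f (C k) / complex_of_real (w (C k) * w (C k))) = f u"
      by (simp add: w_square)
  qed
  finally show ?thesis .
qed

lemma lift_apply: "i \<in> S \<Longrightarrow> j \<in> S \<Longrightarrow> lift a i j = a (C i) (C j) / complex_of_real (w (C i) * w (C j))"
  by (simp add: lift_def)

lemma lift_outside: "i \<notin> S \<or> j \<notin> S \<Longrightarrow> lift a i j = 0"
  by (auto simp: lift_def)

lemma lift_add: "lift (a + b) = lift a + lift b"
  by (intro ext) (simp add: lift_def add_divide_distrib)

lemma lift_diff: "lift (a - b) = lift a - lift b"
  by (intro ext) (simp add: lift_def diff_divide_distrib)

lemma lift_rscale: "lift (rscale r a) = rscale r (lift a)"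
  by (intro ext) (simp add: lift_def)

lemma lift_0: "lift 0 = 0"
  by (intro ext) (simp add: lift_def)

lemma lift_sum: "lift (\<Sum>x\<in>F. f x) = (\<Sum>x\<in>F. lift (f x))"
  by (induction F rule: infinite_finite_induct)
    (auto simp: lift_0 lift_add simp del: plus_fun_apply zero_fun_apply)

lemma lift_mmul: "mmul S (lift a) (lift b) = lift (mmul V a b)"
proof (intro ext)
  fix i j
  show "mmul S (lift a) (lift b) i j = lift (mmul V a b) i j"
  proof (cases "i \<in> S \<and> j \<in> S")
    case True
    have "mmul S (lift a) (lift b) i j
      = (\<Sum>k\<in>S. a (C i) (C k) * b (C k) (C j) / complex_of_real (w (C k) * w (C k))
          / complex_of_real (w (C i) * w (C j)))"
      unfolding mmul_def using True by (intro sum.cong refl) (simp add: lift_apply)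
    also have "\<dots> = (\<Sum>u\<in>V. a (C i) u * b u (C j)) / complex_of_real (w (C i) * w (C j))"
      unfolding sum_divide_distrib[symmetric]
      using sum_classes[of "\<lambda>u. a (C i) u * b u (C j)"] by simp
    finally show ?thesis using True by (simp add: lift_apply mmul_def)
  next
    case False
    then have "mmul S (lift a) (lift b) i j = 0"
      unfolding mmul_def by (intro sum.neutral) (auto simp: lift_outside)
    then show ?thesis using False by (simp add: lift_outside)
  qed
qed

lemma lift_bracket: "bracket S (lift a) (lift b) = lift (bracket V a b)"
  by (simp only: bracket_eq lift_mmul lift_diff)

lemma lift_hs: "hs S (lift a) (lift b) = hs V a b"
proof -
  have "hs S (lift a) (lift b)
    = (\<Sum>i\<in>S. (\<Sum>j\<in>S. cnj (a (C i) (C j)) * b (C i) (C j) / complex_of_real (w (C j) * w (C j)))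
          / complex_of_real (w (C i) * w (C i)))"
    unfolding hs_def sum_divide_distrib
    by (intro sum.cong refl) (simp add: lift_apply mult_ac)
  also have "\<dots> = (\<Sum>i\<in>S. (\<Sum>v\<in>V. cnj (a (C i) v) * b (C i) v) / complex_of_real (w (C i) * w (C i)))"
    using sum_classes[of "\<lambda>v. cnj (a (C i) v) * b (C i) v" for i] by simp
  also have "\<dots> = hs V a b"
    unfolding hs_def by (rule sum_classes)
  finally show ?thesis .
qed

text \<open>\<open>H_C\<close> is in general not a lift, so \<open>lift_hs\<close> does not cover
  it; being diagonal, it meets only the diagonal of the lifted matrix.\<close>

lemma lift_hs_diag:
  "hs S (lift a) (H_C S C) = (\<Sum>u\<in>V. cnj (a u u) * of_int u)"
proof -
  have "(\<Sum>j\<in>S. cnj (lift a i j) * H_C S C i j)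
      = cnj (a (C i) (C i)) * of_int (C i) / complex_of_real (w (C i) * w (C i))" if i: "i \<in> S" for i
  proof -
    have "(\<Sum>j\<in>S. cnj (lift a i j) * H_C S C i j) = (\<Sum>j\<in>S. if j = i then cnj (lift a i i) * of_int (C i) else 0)"
      using i by (intro sum.cong) (auto simp: H_C_def)
    also have "\<dots> = cnj (lift a i i) * of_int (C i)" using i fin by simp
    finally show ?thesis using i by (simp add: lift_apply)
  qed
  then show ?thesis
    unfolding hs_def sum_classes[of "\<lambda>u. cnj (a u u) * of_int u", symmetric] by (intro sum.cong) auto
qed

lemma lift_skew:
  assumes "a \<in> skew V"
  shows "lift a \<in> skew S"
proof (rule skewI)
  show "lift a j i = - cnj (lift a i j)" for i j
    using skew_cnj[OF assms, of "C i" "C j"] by (simp add: lift_def mult.commute)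
qed (rule lift_outside)

lemma lift_eq_0:
  assumes "a \<in> skew V" "lift a = 0"
  shows "a = 0"
proof (intro ext)
  fix u v
  show "a u v = 0 u v"
  proof (cases "u \<in> V \<and> v \<in> V")
    case True
    then obtain i j where ij: "i \<in> S" "j \<in> S" "u = C i" "v = C j" by auto
    have "lift a i j = 0" using assms(2) by simp
    then show ?thesis using ij w_nz by (simp add: lift_apply)
  qed (use skew_outside[OF assms(1)] in auto)
qed

abbreviation D :: "'z cmat" where
  "D \<equiv> diag_mat S (\<lambda>i. real_of_int (C i))"

abbreviation ad_diag :: "int cmat \<Rightarrow> int cmat" where
  "ad_diag a \<equiv> (\<lambda>u v. \<i> * complex_of_real (real_of_int u - real_of_int v) * a u v)"

text \<open>Although \<open>D\<close> is in general not a lift, it is constant on cost classes, so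
  its bracket preserves lifts and acts on them as the diagonal matrix of the costs.\<close>

lemma bracket_D_lift: "bracket S D (lift a) = lift (ad_diag a)"
proof -
  have "bracket S D (lift a) = (\<lambda>i j. \<i> * complex_of_real (real_of_int (C i) - real_of_int (C j)) * lift a i j)"
    by (rule bracket_diag_mat[OF fin lift_outside])
  then show ?thesis by (simp only:) (intro ext, simp add: lift_def)
qed

lemma ad_diag_traceless_skew: "a \<in> skew V \<Longrightarrow> ad_diag a \<in> traceless_skew V"
  using bracket_in_traceless_skew[OF diag_mat_skew, of a V real_of_int]
    bracket_diag_mat[OF finV skew_outside[of a V], where d = real_of_int] by simp

section \<open>Upper and lower descriptions of the generated algebra\<close>

abbreviation psi :: "int \<Rightarrow> complex" where
  "psi u \<equiv> complex_of_real (w u)"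

lemma imul_H_C: "imul (H_C S C) = D"
  by (intro ext) (simp add: imul_def H_C_def diag_mat_def)

text \<open>The entries \<open>w u * w v\<close> of the projection onto \<open>psi\<close> cancel
  the normalisation in \<open>lift\<close>, leaving all ones; the wedge counts this projection
  twice, whence \<open>1/2\<close>.\<close>

lemma imul_H_M: "imul (H_M S) = rscale (1/2) (lift (wedge (\<lambda>u. \<i> * psi u) psi))"
  by (intro ext) (simp add: imul_def H_M_def lift_def wedge_apply w_nz)

abbreviation dla :: "'z cmat set" where "dla \<equiv> qwoa_dla S C"

lemma gen_lie_eq: "gen_lie S X = \<Inter> {G. cm.subspace G \<and> X \<subseteq> G \<and> lie_closed S G}"
  by (simp add: gen_lie_def rsubspace_iff)

lemma dla_subspace: "cm.subspace dla"
  unfolding qwoa_dla_def gen_lie_eq by (rule cm.subspace_Inter) auto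

lemma dla_lie_closed: "lie_closed S dla"
  unfolding qwoa_dla_def gen_lie_eq by (auto simp: lie_closed_def)

lemma dla_generators: "D \<in> dla" "imul (H_M S) \<in> dla"
  unfolding qwoa_dla_def gen_lie_eq imul_H_C by auto

text \<open>The preimage of \<open>dla\<close> under \<open>lift\<close> is a Lie algebra of
  matrices indexed by costs. There the diagonal entries are the distinct costs and
  \<open>psi\<close> has no zero entry, so \<open>psi\<close> is cyclic.\<close>

lemma lift_skew_subset_dla: "lift ` skew V \<subseteq> dla"
proof -
  have "skew V \<subseteq> {a. lift a \<in> dla}"
  proof (rule skew_subset_lie_closed[OF finV, where d = real_of_int and p = psi])
    show "cm.subspace {a. lift a \<in> dla}"
      using cm.subspace_0[OF dla_subspace] cm.subspace_add[OF dla_subspace] cm.subspace_scale[OF dla_subspace]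
      by (intro cm.subspaceI) (simp_all add: lift_0 lift_add lift_rscale)
    show "lie_closed V {a. lift a \<in> dla}"
      using dla_lie_closed by (simp add: lie_closed_def lift_bracket[symmetric])
    show "ad_diag a \<in> {a. lift a \<in> dla}" if "a \<in> {a. lift a \<in> dla}" for a
    proof -
      have "bracket S D (lift a) \<in> dla"
        using dla_lie_closed dla_generators(1) that by (simp add: lie_closed_def)
      then show ?thesis by (simp only: bracket_D_lift mem_Collect_eq)
    qed
    have "rscale 2 (imul (H_M S)) \<in> dla"
      by (rule cm.subspace_scale[OF dla_subspace dla_generators(2)])
    then show "wedge (\<lambda>k. \<i> * psi k) psi \<in> {a. lift a \<in> dla}"
      by (simp add: imul_H_M)
  qed (use w_nz w_outside in \<open>auto simp: inj_on_def\<close>)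
  then show ?thesis by blast
qed

text \<open>\<open>D\<close> commutes with itself, so no multiple of \<open>D\<close> survives in a
  bracket; what remains is a sum of commutators on the cost space and hence traceless.\<close>

lemma bracket_lift_D:
  assumes a: "a \<in> skew V" and b: "b \<in> skew V"
  shows "bracket S (lift a + rscale t D) (lift b + rscale r D) \<in> lift ` traceless_skew V"
proof -
  have "bracket S D D = 0" by (simp add: bracket_eq)
  moreover have "bracket S (lift a) D = rscale (- 1) (lift (ad_diag a))"
    using bracket_anticomm[of S D "lift a"] by (simp add: bracket_D_lift)
  ultimately have "bracket S (lift a + rscale t D) (lift b + rscale r D)
      = lift (bracket V a b + rscale (- r) (ad_diag a) + rscale t (ad_diag b))"
    by (simp add: bracket_simps lift_bracket bracket_D_lift lift_add lift_diff lift_rscale)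
  moreover have "bracket V a b + rscale (- r) (ad_diag a) + rscale t (ad_diag b) \<in> traceless_skew V"
    using a b by (intro cm.subspace_add[OF subspace_traceless_skew]
      cm.subspace_scale[OF subspace_traceless_skew] ad_diag_traceless_skew bracket_in_traceless_skew)
  ultimately show ?thesis by blast
qed

lemma traceless_skew_imp_skew: "a \<in> traceless_skew T \<Longrightarrow> a \<in> skew T"
  by (simp add: traceless_skew_def)

text \<open>The sums of a lift and a multiple of \<open>D\<close> form a Lie algebra containing both
  generators, so the smallest such algebra lies inside.\<close>

lemma dla_cases:
  assumes "A \<in> dla"
  obtains a t where "a \<in> skew V" "A = lift a + rscale t D"
proof -
  define E where "E = {A. \<exists>a t. a \<in> skew V \<and> A = lift a + rscale t D}"
  have EI: "lift a + rscale t D \<in> E" if "a \<in> skew V" for a t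
    using that by (auto simp: E_def)
  have "cm.subspace E"
  proof (rule cm.subspaceI)
    show "0 \<in> E" using EI[OF cm.subspace_0[OF subspace_skew], of 0] by (simp add: lift_0)
    fix A B r assume "A \<in> E"
    then obtain a t where a: "a \<in> skew V" "A = lift a + rscale t D" by (auto simp: E_def)
    have "rscale r A = lift (rscale r a) + rscale (r * t) D"
      by (simp add: a(2) lift_rscale cm.scale_right_distrib)
    then show "rscale r A \<in> E"
      using EI[OF cm.subspace_scale[OF subspace_skew a(1)]] by simp
    assume "B \<in> E"
    then obtain b q where b: "b \<in> skew V" "B = lift b + rscale q D" by (auto simp: E_def)
    have "A + B = lift (a + b) + rscale (t + q) D"
      by (simp add: a(2) b(2) lift_add cm.scale_left_distrib)
    then show "A + B \<in> E"
      using EI[OF cm.subspace_add[OF subspace_skew a(1) b(1)]] by simp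
  qed
  moreover have "lie_closed S E"
    unfolding lie_closed_def
  proof (intro ballI)
    fix A B assume "A \<in> E" "B \<in> E"
    then obtain c where c: "c \<in> traceless_skew V" "bracket S A B = lift c"
      using bracket_lift_D by (fastforce simp: E_def)
    then show "bracket S A B \<in> E"
      using EI[OF traceless_skew_imp_skew[OF c(1)], of 0] by simp
  qed
  moreover have "D \<in> E"
    using EI[OF cm.subspace_0[OF subspace_skew], of 1] by (simp add: lift_0)
  moreover have "imul (H_M S) \<in> E"
  proof -
    have "wedge (\<lambda>u. \<i> * psi u) psi \<in> skew V"
      by (rule wedge_skew) (simp_all add: w_outside)
    then have "rscale (1/2) (wedge (\<lambda>u. \<i> * psi u) psi) \<in> skew V"
      by (rule cm.subspace_scale[OF subspace_skew])
    from EI[OF this, of 0] show ?thesis by (simp add: imul_H_M lift_rscale)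
  qed
  ultimately have "dla \<subseteq> E"
    unfolding qwoa_dla_def gen_lie_eq imul_H_C by blast
  then show ?thesis using assms that by (auto simp: E_def)
qed

abbreviation su :: "'z cmat set" where "su \<equiv> lift ` traceless_skew V"

lemma bracket_dla: "A \<in> dla \<Longrightarrow> B \<in> dla \<Longrightarrow> bracket S A B \<in> su"
  by (metis dla_cases bracket_lift_D)

lemma su_subset_dla: "su \<subseteq> dla"
  using lift_skew_subset_dla traceless_skew_imp_skew by blast

lemma su_subset_skew: "su \<subseteq> skew S"
  using lift_skew traceless_skew_imp_skew by blast

lemma su_subspace: "cm.subspace su"
proof (rule cm.subspaceI)
  show "0 \<in> su" using cm.subspace_0[OF subspace_traceless_skew] lift_0 by force
  fix A B r assume "A \<in> su"
  then obtain a where a: "a \<in> traceless_skew V" "A = lift a" by blast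
  show "rscale r A \<in> su"
    using cm.subspace_scale[OF subspace_traceless_skew a(1)] by (auto simp: a(2) lift_rscale[symmetric])
  assume "B \<in> su"
  then obtain b where b: "b \<in> traceless_skew V" "B = lift b" by blast
  show "A + B \<in> su"
    using cm.subspace_add[OF subspace_traceless_skew a(1) b(1)] by (auto simp: a(2) b(2) lift_add[symmetric])
qed

text \<open>Pulls \<open>J\<close> back along \<open>lift\<close> and applies
  \<open>traceless_skew_simple\<close> on the cost space.\<close>

lemma ideal_su:
  assumes "lie_ideal S su J"
  shows "J = {0} \<or> J = su"
proof (cases "J \<subseteq> {0}")
  case True
  have "0 \<in> J" using assms cm.subspace_0 by (auto simp: lie_ideal_def rsubspace_iff)
  then show ?thesis using True by blast
next
  case False
  have J: "cm.subspace J" "J \<subseteq> su" and Ji: "\<And>A B. A \<in> su \<Longrightarrow> B \<in> J \<Longrightarrow> bracket S A B \<in> J"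
    using assms by (auto simp: lie_ideal_def rsubspace_iff)
  define J' where "J' = {a \<in> traceless_skew V. lift a \<in> J}"
  obtain A where "A \<in> J" "A \<noteq> 0" using False by blast
  then obtain a where a: "a \<in> traceless_skew V" "lift a \<in> J" "lift a \<noteq> 0" using J(2) by blast
  have "J' = traceless_skew V"
  proof (rule traceless_skew_simple[OF finV])
    show "cm.subspace J'"
      unfolding J'_def
      using cm.subspace_0[OF J(1)] cm.subspace_add[OF J(1)] cm.subspace_scale[OF J(1)]
        cm.subspace_0[OF subspace_traceless_skew, of V] cm.subspace_add[OF subspace_traceless_skew, of _ V]
        cm.subspace_scale[OF subspace_traceless_skew, of _ V]
      by (intro cm.subspaceI) (simp_all add: lift_0 lift_add lift_rscale)
    show "bracket V x y \<in> J'" if "x \<in> traceless_skew V" "y \<in> J'" for x y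
      using that Ji[of "lift x" "lift y"]
        bracket_in_traceless_skew[OF traceless_skew_imp_skew traceless_skew_imp_skew, of x V y]
      by (auto simp: J'_def lift_bracket)
    show "a \<in> J'" using a by (simp add: J'_def)
    show "a \<noteq> 0" using a(3) lift_0 by auto
  qed (auto simp: J'_def)
  then show ?thesis using J(2) by (auto simp: J'_def)
qed

end

text \<open>Two distinct costs make \<open>su\<close> nonabelian. With fewer, \<open>su\<close>
  would be zero, all brackets in \<open>dla\<close> would vanish and there would be no simple
  ideal.\<close>

locale nonconstant_classes = value_classes S C
  for S :: "'z set" and C :: "'z \<Rightarrow> int" +
  fixes u v :: int
  assumes uv: "u \<in> V" "v \<in> V" "u \<noteq> v"
begin

lemma su_nonabelian: "\<exists>A\<in>su. \<exists>B\<in>su. bracket S A B \<noteq> 0"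
proof -
  let ?b = "unit_mat u u (2 * \<i>) - unit_mat v v (2 * \<i>)"
  have br: "bracket V (pair_mat u v 1) (pair_mat u v \<i>) = ?b"
    using bracket_pair_mat_diag[OF finV uv] .
  have pm: "pair_mat u v z \<in> traceless_skew V" for z
    using uv by (rule pair_mat_traceless_skew)
  have "?b u u = 2 * \<i>" using uv(3) by (simp add: unit_mat_def)
  then have "?b \<noteq> 0" by (metis complex_i_not_zero mult_eq_0_iff zero_fun_apply zero_neq_numeral)
  moreover have "?b \<in> skew V"
    unfolding br[symmetric] by (intro bracket_in_skew traceless_skew_imp_skew pm)
  ultimately have "lift ?b \<noteq> 0" using lift_eq_0 by blast
  then have "bracket S (lift (pair_mat u v 1)) (lift (pair_mat u v \<i>)) \<noteq> 0"
    by (simp only: lift_bracket br not_False_eq_True)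
  then show ?thesis using pm by blast
qed

lemma lie_ideal_dla_su: "lie_ideal S dla su"
  unfolding lie_ideal_def rsubspace_iff
proof (intro conjI ballI su_subspace su_subset_dla)
  fix A B assume A: "A \<in> dla" and "B \<in> su"
  then have "B \<in> dla" using su_subset_dla by (rule_tac subsetD)
  with A show "bracket S A B \<in> su" by (rule bracket_dla)
qed

text \<open>A nonzero bracket inside \<open>I\<close> lies in \<open>I \<inter> su\<close>, which is
  an ideal of \<open>su\<close> and so equals it. Thus \<open>su\<close> is a nonzero ideal of
  \<open>I\<close>, and simplicity of \<open>I\<close> forces equality.\<close>

lemma simple_ideal_dla_unique:
  assumes "simple_ideal S dla I"
  shows "I = su"
proof -
  have ideal: "lie_ideal S dla I" and na: "\<exists>A\<in>I. \<exists>B\<in>I. bracket S A B \<noteq> 0"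
    and simple: "\<forall>J. lie_ideal S I J \<longrightarrow> J = {0} \<or> J = I"
    using assms unfolding simple_ideal_def zmat_eq_0 by simp_all
  have I: "cm.subspace I" "I \<subseteq> dla" "\<forall>A\<in>dla. \<forall>B\<in>I. bracket S A B \<in> I"
    using ideal unfolding lie_ideal_def rsubspace_iff by simp_all
  obtain A B where AB: "A \<in> I" "B \<in> I" "bracket S A B \<noteq> 0"
    using na by (elim bexE)
  note Idla = subsetD[OF I(2)]
  have "bracket S A B \<in> I \<inter> su"
    using I(3)[rule_format, OF Idla[OF AB(1)] AB(2)] bracket_dla[OF Idla[OF AB(1)] Idla[OF AB(2)]]
    by (rule IntI)
  with AB(3) have "I \<inter> su \<noteq> {0}" by (elim contrapos_nn) simp
  moreover have "lie_ideal S su (I \<inter> su)"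
    unfolding lie_ideal_def rsubspace_iff
  proof (intro conjI ballI cm.subspace_inter I(1) su_subspace Int_lower2)
    fix A B assume A: "A \<in> su" and B: "B \<in> I \<inter> su"
    have A': "A \<in> dla" using su_subset_dla A by (rule subsetD)
    show "bracket S A B \<in> I \<inter> su"
      using I(3)[rule_format, OF A' IntD1[OF B]] bracket_dla[OF A' Idla[OF IntD1[OF B]]]
      by (rule IntI)
  qed
  then have "I \<inter> su = {0} \<or> I \<inter> su = su" by (rule ideal_su)
  ultimately have "I \<inter> su = su" by (simp only: simp_thms)
  then have suI: "su \<subseteq> I" using Int_lower1[of I su] by (simp only:)
  have "lie_ideal S I su"
    unfolding lie_ideal_def rsubspace_iff
  proof (intro conjI ballI su_subspace suI)
    fix A B assume "A \<in> I" "B \<in> su"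
    then show "bracket S A B \<in> su"
      by (intro bracket_dla Idla subsetD[OF su_subset_dla])
  qed
  then have "su = {0} \<or> su = I" using simple by simp
  moreover have "su \<noteq> {0}"
  proof
    assume su0: "su = {0}"
    then show False using su_nonabelian by (simp only: su0 bex_simps bracket_0) simp
  qed
  ultimately show "I = su" by simp
qed

lemma simple_ideals_dla: "{I. simple_ideal S dla I} = {su}"
proof -
  have "simple_ideal S dla su"
    unfolding simple_ideal_def zmat_eq_0
    by (intro conjI lie_ideal_dla_su su_nonabelian allI impI ideal_su)
  show ?thesis
  proof (rule set_eqI)
    fix I show "I \<in> {I. simple_ideal S dla I} \<longleftrightarrow> I \<in> {su}"
      unfolding mem_Collect_eq singleton_iff
    proof
      assume "I = su"
      then show "simple_ideal S dla I" using \<open>simple_ideal S dla su\<close> by (simp only:)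
    qed (rule simple_ideal_dla_unique)
  qed
qed

lemma qwoa_variance_eq:
  "qwoa_variance S C = purity S su (rho0 S) * purity S su (H_C S C) / real (rdim su)"
  by (simp add: qwoa_variance_def lie_variance_def simple_ideals_dla)

section \<open>Dimension bound, purity bounds and the variance\<close>

definition units :: "'z cmat set" where
  "units = (\<lambda>(p, q). lift (unit_mat p q 1)) ` (V \<times> V) \<union> (\<lambda>(p, q). lift (unit_mat p q \<i>)) ` (V \<times> V)"

lemma finite_units: "finite units"
  using fin by (simp add: units_def)

lemma card_units: "card units \<le> 2 * (card V)\<^sup>2"
proof -
  have "card units \<le> card (V \<times> V) + card (V \<times> V)"
    unfolding units_def using fin
    by (intro order.trans[OF card_Un_le] add_mono card_image_le) auto
  then show ?thesis by (simp add: card_cartesian_product power2_eq_square)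
qed

text \<open>Real and imaginary parts of every entry give a real spanning set of at most
  \<open>2 * (card V)\<^sup>2\<close> elements. It spans more than \<open>su\<close>, which suffices
  for an upper bound on the dimension.\<close>

lemma su_subset_span_units: "su \<subseteq> cm.span units"
proof
  fix A assume "A \<in> su"
  then obtain a where a: "a \<in> skew V" "A = lift a" using traceless_skew_imp_skew by blast
  define t where "t p q = rscale (Re (a p q)) (unit_mat p q 1) + rscale (Im (a p q)) (unit_mat p q \<i>)" for p q
  have "(\<Sum>p\<in>V. \<Sum>q\<in>V. t p q) i j = a i j" for i j
  proof -
    have "t p q i j = (if p = i \<and> q = j then a p q else 0)" for p q
      by (auto simp: t_def unit_mat_def complex_eq_iff)
    then have "(\<Sum>p\<in>V. \<Sum>q\<in>V. t p q) i j = (if i \<in> V \<and> j \<in> V then a i j else 0)"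
      by (simp only: sum_fun_apply sum_sum_delta[OF finV])
    then show ?thesis using skew_outside[OF a(1), of i j] by (cases "i \<in> V \<and> j \<in> V") auto
  qed
  then have "a = (\<Sum>p\<in>V. \<Sum>q\<in>V. t p q)" by (intro ext) simp
  then have "A = (\<Sum>p\<in>V. \<Sum>q\<in>V. lift (t p q))" by (simp only: a(2) lift_sum)
  moreover have "lift (t p q) \<in> cm.span units" if "p \<in> V" "q \<in> V" for p q
    unfolding t_def lift_add lift_rscale
    by (intro cm.span_add cm.span_scale cm.span_base) (use that in \<open>auto simp: units_def\<close>)
  ultimately show "A \<in> cm.span units"
    by (auto intro!: cm.span_sum)
qed

lemma ex_hs_onb_su: "\<exists>B. hs_onb S su B"
  using ex_hs_onb[OF fin finite_units su_subset_span_units su_subspace su_subset_skew] .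

lemma rdim_su: "0 < rdim su" "rdim su \<le> 2 * (card V)\<^sup>2"
proof -
  have ne: "\<exists>A\<in>su. A \<noteq> 0"
    using su_nonabelian bracket_0 by metis
  show "0 < rdim su" "rdim su \<le> 2 * (card V)\<^sup>2"
    using rdim_bounds[OF su_subspace finite_units su_subset_span_units ne] card_units by linarith+
qed

text \<open>The test element has squared norm 2, and its pairing with \<open>H_C\<close> has modulus
  equal to the gap between the costs \<open>u\<close> and \<open>v\<close>. Costs are integers, so
  the gap is at least 1.\<close>

lemma purity_H_C: "purity S su (H_C S C) \<ge> 1 / 2"
proof -
  define d :: "int \<Rightarrow> real" where "d k = (if k = u then 1 else 0) - (if k = v then 1 else 0)" for k
  define a where "a = diag_mat V d"
  have s: "(\<Sum>k\<in>V. d k * f k) = f u - f v" for f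
  proof -
    have "(\<Sum>k\<in>V. d k * f k) = (\<Sum>k\<in>V. (if k = u then f k else 0) - (if k = v then f k else 0))"
      by (intro sum.cong) (auto simp: d_def)
    then show ?thesis using finV uv by (simp add: sum_subtractf)
  qed
  have "a \<in> traceless_skew V"
    unfolding a_def using s[of "\<lambda>_. 1"] by (intro diag_mat_traceless_skew) simp
  then have bound: "(cmod (hs S (lift a) (H_C S C)))\<^sup>2 \<le> Re (hs S (lift a) (lift a)) * purity S su (H_C S C)"
    by (intro purity_ge[OF ex_hs_onb_su]) blast
  have norm_a: "Re (hs S (lift a) (lift a)) = 2"
    using s[of d] uv(3) unfolding lift_hs a_def hs_diag_mat[OF finV]
    by (simp add: power2_eq_square d_def)
  have "hs S (lift a) (H_C S C) = - \<i> * complex_of_real (real_of_int (u - v))"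
  proof -
    have "hs S (lift a) (H_C S C) = (\<Sum>k\<in>V. - \<i> * complex_of_real (d k * real_of_int k))"
      unfolding lift_hs_diag a_def by (intro sum.cong) (auto simp: diag_mat_def)
    also have "\<dots> = - \<i> * complex_of_real (\<Sum>k\<in>V. d k * real_of_int k)"
      by (simp add: sum_distrib_left)
    finally show ?thesis by (simp add: s)
  qed
  then have "(cmod (hs S (lift a) (H_C S C)))\<^sup>2 = (real_of_int (u - v))\<^sup>2"
    by (simp only: norm_mult norm_minus_cancel norm_ii norm_of_real power2_abs mult_1)
  with bound have "(real_of_int (u - v))\<^sup>2 \<le> 2 * purity S su (H_C S C)"
    by (simp only: norm_a)
  moreover have "1 \<le> (real_of_int (u - v))\<^sup>2"
  proof -
    have "1 \<le> \<bar>u - v\<bar>" using uv(3) by linarith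
    then have "1 \<le> \<bar>real_of_int (u - v)\<bar>" by linarith
    then show ?thesis by (metis one_le_power power2_abs)
  qed
  ultimately show ?thesis by linarith
qed

lemma card_V_ge_2: "2 \<le> card V"
proof -
  have "card {u, v} \<le> card V" using uv finV by (intro card_mono) auto
  then show ?thesis using uv(3) by simp
qed

text \<open>On the cost space \<open>rho0\<close> is the rank-one projection \<open>q\<close>. The
  test element is \<open>\<i>\<close> times its traceless part \<open>q - e\<close>, where
  \<open>e\<close> is the identity divided by \<open>m\<close>.\<close>

lemma purity_rho0: "purity S su (rho0 S) \<ge> 1 / 2"
proof -
  define n where "n = real (card S)"
  define m where "m = real (card V)"
  have n: "n > 0" using uv(1) fin by (auto simp: n_def card_gt_0_iff)
  have m: "m \<ge> 2" using card_V_ge_2 by (simp add: m_def)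
  define q where "q x y = w x * w y / n" for x y
  define e where "e x y = (if x = y \<and> x \<in> V then 1 / m else 0)" for x y :: int
  have rho: "rho0 S = lift (\<lambda>x y. complex_of_real (q x y))"
    by (intro ext) (simp add: rho0_def lift_def q_def n_def w_nz)
  define a where "a = (\<lambda>x y. \<i> * complex_of_real (q x y - e x y))"
  have tr_q: "(\<Sum>x\<in>V. q x x) = 1"
    unfolding q_def sum_divide_distrib[symmetric] sum_w_square using n by (simp add: n_def)
  have tr_e: "(\<Sum>x\<in>V. e x x) = 1"
    using m by (simp add: e_def m_def[symmetric])
  \<comment> \<open>Rank one with trace one gives Hilbert-Schmidt norm one.\<close>
  have qq: "(\<Sum>x\<in>V. \<Sum>y\<in>V. q x y * q x y) = 1"
  proof -
    have "q x y * q x y = q x x * q y y" for x y by (simp add: q_def)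
    then have "(\<Sum>x\<in>V. \<Sum>y\<in>V. q x y * q x y) = (\<Sum>x\<in>V. q x x) * (\<Sum>y\<in>V. q y y)"
      by (simp add: sum_product)
    then show ?thesis by (simp add: tr_q)
  qed
  have e_sum: "(\<Sum>x\<in>V. \<Sum>y\<in>V. e x y * f x y) = (\<Sum>x\<in>V. f x x) / m" for f
  proof -
    have "(\<Sum>y\<in>V. e x y * f x y) = f x x / m" if "x \<in> V" for x
    proof -
      have "(\<Sum>y\<in>V. e x y * f x y) = (\<Sum>y\<in>V. if y = x then f x x / m else 0)"
        using that by (intro sum.cong) (auto simp: e_def)
      then show ?thesis using that finV by simp
    qed
    then show ?thesis by (simp add: sum_divide_distrib)
  qed
  have bq: "(\<Sum>x\<in>V. \<Sum>y\<in>V. (q x y - e x y) * q x y) = 1 - 1 / m"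
    by (simp add: left_diff_distrib sum_subtractf qq e_sum tr_q)
  \<comment> \<open>The traceless part is orthogonal to the identity, so its pairing with
    \<open>q\<close> equals its own squared norm; Bessel's inequality can then be divided by this
    common value.\<close>
  have be: "(\<Sum>x\<in>V. \<Sum>y\<in>V. (q x y - e x y) * e x y) = 0"
    using e_sum[of "\<lambda>x y. q x y - e x y"] by (simp add: mult.commute sum_subtractf tr_q tr_e)
  have bb: "(\<Sum>x\<in>V. \<Sum>y\<in>V. (q x y - e x y) * (q x y - e x y)) = 1 - 1 / m"
    using bq be by (simp add: right_diff_distrib sum_subtractf)
  have "a \<in> skew V"
  proof (rule skewI)
    show "a x y = 0" if "x \<notin> V \<or> y \<notin> V" for x y
      using that w_outside[of x] w_outside[of y] by (auto simp: a_def q_def e_def)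
    have "q y x - e y x = q x y - e x y" for x y
      by (auto simp: q_def e_def)
    then show "a y x = - cnj (a x y)" for x y
      unfolding a_def by simp
  qed
  moreover have "(\<Sum>x\<in>V. a x x) = \<i> * complex_of_real (\<Sum>x\<in>V. q x x - e x x)"
    by (simp only: a_def of_real_sum sum_distrib_left)
  ultimately have "a \<in> traceless_skew V"
    by (simp add: traceless_skew_def sum_subtractf tr_q tr_e)
  then have "(cmod (hs S (lift a) (rho0 S)))\<^sup>2 \<le> Re (hs S (lift a) (lift a)) * purity S su (rho0 S)"
    by (intro purity_ge[OF ex_hs_onb_su]) blast
  moreover have "hs S (lift a) (lift a) = complex_of_real (1 - 1 / m)"
  proof -
    have "cnj (\<i> * complex_of_real t) * (\<i> * complex_of_real t) = complex_of_real (t * t)" for t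
      by (simp add: mult_ac)
    then have "cnj (a x y) * a x y = complex_of_real ((q x y - e x y) * (q x y - e x y))" for x y
      by (simp only: a_def)
    then show ?thesis unfolding lift_hs unfolding hs_def by (simp only: of_real_sum[symmetric] bb)
  qed
  moreover have "hs S (lift a) (rho0 S) = - \<i> * complex_of_real (1 - 1 / m)"
  proof -
    have "cnj (a x y) * complex_of_real (q x y) = - \<i> * complex_of_real ((q x y - e x y) * q x y)" for x y
      by (simp add: a_def)
    then show ?thesis unfolding rho lift_hs unfolding hs_def
      by (simp only: sum_distrib_left[symmetric] of_real_sum[symmetric] bq)
  qed
  then have "(cmod (hs S (lift a) (rho0 S)))\<^sup>2 = (1 - 1 / m)\<^sup>2"
    by (simp only: norm_mult norm_minus_cancel norm_ii norm_of_real power2_abs mult_1)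
  ultimately have "(1 - 1 / m) * (1 - 1 / m) \<le> (1 - 1 / m) * purity S su (rho0 S)"
    by (simp add: power2_eq_square)
  moreover have half: "1 - 1 / m \<ge> 1 / 2" using m by (simp add: field_simps)
  then have "0 < 1 - 1 / m" by linarith
  ultimately have "1 - 1 / m \<le> purity S su (rho0 S)"
    by (simp only: mult_le_cancel_left_pos)
  then show ?thesis using half by linarith
qed

lemma qwoa_variance_ge: "qwoa_variance S C \<ge> 1 / (8 * (real (card V))\<^sup>2)"
proof -
  have "real (rdim su) \<le> 2 * (real (card V))\<^sup>2"
    using rdim_su(2) by (metis of_nat_le_iff of_nat_mult of_nat_numeral of_nat_power)
  moreover have "1 / 4 \<le> purity S su (rho0 S) * purity S su (H_C S C)"
    using mult_mono[OF purity_rho0 purity_H_C] purity_rho0 by simp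
  ultimately have "(1 / 4) / (2 * (real (card V))\<^sup>2) \<le> qwoa_variance S C"
    unfolding qwoa_variance_eq using rdim_su(1) by (intro frac_le) auto
  then show ?thesis by simp
qed

end

theorem theorem4:
  fixes isize :: "'inst \<Rightarrow> nat"
    and feas :: "'inst \<Rightarrow> bool list set"
    and cost :: "'inst \<Rightarrow> bool list \<Rightarrow> int"
  assumes sol_poly: "\<exists>a k. \<forall>x. \<forall>z\<in>feas x. length z \<le> a * (isize x + 1) ^ k"
    and range_poly: "\<exists>a k. \<forall>x. \<exists>lo hi. (\<forall>z\<in>feas x. lo \<le> cost x z \<and> cost x z \<le> hi) \<and>
                        hi - lo + 1 \<le> int (a * (isize x + 1) ^ k)"
  shows "\<exists>c>0. \<exists>k::nat. \<exists>N0. \<forall>x. isize x \<ge> N0 \<longrightarrow>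
           (\<exists>z\<in>feas x. \<exists>w\<in>feas x. cost x z \<noteq> cost x w) \<longrightarrow>
           qwoa_variance (feas x) (cost x) \<ge> c / real (isize x + 1) ^ k"
proof -
  obtain a k where ak: "\<And>x. \<forall>z\<in>feas x. length z \<le> a * (isize x + 1) ^ k"
    using sol_poly by blast
  \<comment> \<open>Feasible solutions are bit strings of bounded length.\<close>
  have fin: "finite (feas x)" for x
    using finite_lists_length_le[of "UNIV :: bool set"] ak[of x]
    by (rule_tac finite_subset[of _ "{xs. set xs \<subseteq> UNIV \<and> length xs \<le> a * (isize x + 1) ^ k}"]) auto
  obtain b l where bl: "\<And>x. \<exists>lo hi. (\<forall>z\<in>feas x. lo \<le> cost x z \<and> cost x z \<le> hi) \<and>
                        hi - lo + 1 \<le> int (b * (isize x + 1) ^ l)"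
    using range_poly by blast
  \<comment> \<open>Using \<open>b + 1\<close> in place of \<open>b\<close> keeps the constant
    positive even when \<open>b\<close> is 0. The exponent \<open>2 * l\<close> comes from squaring
    the bound on the number of costs.\<close>
  have bound: "1 / (8 * (real b + 1)\<^sup>2) / real (isize x + 1) ^ (2 * l) \<le> qwoa_variance (feas x) (cost x)"
    if nonconst: "\<exists>z\<in>feas x. \<exists>w\<in>feas x. cost x z \<noteq> cost x w" for x
  proof -
    obtain z w where zw: "z \<in> feas x" "w \<in> feas x" "cost x z \<noteq> cost x w" using nonconst by blast
    interpret nonconstant_classes "feas x" "cost x" "cost x z" "cost x w"
      by unfold_locales (use zw fin in auto)
    obtain lo hi where lh: "\<forall>z\<in>feas x. lo \<le> cost x z \<and> cost x z \<le> hi"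
        "hi - lo + 1 \<le> int (b * (isize x + 1) ^ l)"
      using bl by blast
    define m where "m = card (cost x ` feas x)"
    have "m \<le> card {lo..hi}"
      unfolding m_def using lh(1) by (intro card_mono) auto
    also have "\<dots> = nat (hi - lo + 1)" by simp
    also have "\<dots> \<le> nat (int (b * (isize x + 1) ^ l))" using lh(2) by (rule nat_mono)
    also have "\<dots> = b * (isize x + 1) ^ l" by (rule nat_int)
    finally have "real m \<le> real (b * (isize x + 1) ^ l)" by (simp only: of_nat_le_iff)
    also have "\<dots> \<le> (real b + 1) * real (isize x + 1) ^ l"
      unfolding of_nat_mult of_nat_power by (intro mult_right_mono) auto
    finally have "(real m)\<^sup>2 \<le> ((real b + 1) * real (isize x + 1) ^ l)\<^sup>2"
      by (intro power_mono) auto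
    also have "\<dots> = (real b + 1)\<^sup>2 * real (isize x + 1) ^ (2 * l)"
      by (simp only: power_mult_distrib power_mult[symmetric] mult.commute)
    finally have m_le: "(real m)\<^sup>2 \<le> (real b + 1)\<^sup>2 * real (isize x + 1) ^ (2 * l)" .
    have "1 / (8 * (real b + 1)\<^sup>2) / real (isize x + 1) ^ (2 * l)
        = 1 / (8 * ((real b + 1)\<^sup>2 * real (isize x + 1) ^ (2 * l)))"
      by (simp only: divide_divide_eq_left mult.assoc)
    also have "\<dots> \<le> 1 / (8 * (real m)\<^sup>2)"
      using m_le card_V_ge_2 by (intro divide_left_mono) (auto simp: m_def)
    also have "\<dots> \<le> qwoa_variance (feas x) (cost x)"
      unfolding m_def by (rule qwoa_variance_ge)
    finally show ?thesis .
  qed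
  show ?thesis
  proof (intro exI conjI allI impI)
    show "0 < 1 / (8 * (real b + 1)\<^sup>2)" by simp
  qed (rule bound)
qed

end
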